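(* Let $(X,x_0)$ be a pointed topological space. If $G$ is a normal subgroup of $\pi_1(X,x_0)$, then the following conditions are equivalent: (a) the endpoint projection $p_G\colon(\widetilde X_G,\widetilde x_0)\to (X,x_0)$ has the unique path lifting property; (b) $G$ is closed in $\pi_1(X,x_0)$; (c) $\pi_1(p_G)\colon \pi_1(\widetilde X_G,\widetilde x_0)\to\pi_1(X,x_0)$ is a monomorphism and its image equals $G$.
   Context: For an open cover $\mathcal U$ of $X$ and $x_1\in X$, $\pi(\mathcal U,x_1)$ is the subgroup of $\pi_1(X,x_1)$ generated by all $[\alpha\ast\gamma\ast\alpha^{-1}]$, where $\gamma$ is a loop in some $U\in\mathcal U$ and $\alpha$ is a path in $X$ from $x_1$ to $\gamma(0)$. For a subgroup $H$ of $\pi_1(X,x_0)$, $\widetilde X_H$ is the set of equivalence classes $[\alpha]_H$ of paths $\alpha$ in $X$ with $\alpha(0)=x_0$ under the relation: $\alpha\sim_H\beta$ iff $\alpha(1)=\beta(1)$ and $[\alpha\ast\beta^{-1}]\in H$. It carries the topology with basis the sets $B_H([\alpha]_H,\mathcal U,V)$, where $\mathcal U$ is an open cover of $X$, $\alpha$ is a path originating at $x_0$, $V\in\mathcal U$ contains $\alpha(1)$, and $[\beta]_H\in B_H([\alpha]_H,\mathcal U,V)$ iff there are a path $\gamma_0$ in $V$ originating at $\alpha(1)$ and a loop $\lambda$ at $\alpha(1)$ with $[\lambda]\in\pi(\mathcal U,\alpha(1))$ and $\beta\sim_H\alpha\ast\lambda\ast\gamma_0$. The base-point $\widetilde x_0$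 is the class of the constant path at $x_0$. The endpoint projection is $p_H([\alpha]_H)=\alpha(1)$. When $H=\{1\}$ write $\widetilde X$ for $\widetilde X_H$. The group $\pi_1(X,x_0)$ is the fiber over $x_0$ of the endpoint projection $\widetilde X\to X$; it is topologized as a subspace of $\widetilde X$. A pointed map $f\colon (A,a_0)\to (B,b_0)$ has the unique path lifting property if (i) every path $\alpha\colon(I,0)\to(B,b_0)$ has a lift $\beta\colon (I,0)\to(A,a_0)$ (i.e. $f\circ\beta=\alpha$), and (ii) any two paths $\alpha,\beta\colon(I,0)\to(A,a_0)$ with $f\circ\alpha=f\circ\beta$ are equal. *)

theory Defs
  imports "HOL-Analysis.Analysis" "HOL-Algebra.Generated_Groups"
begin

text \<open>
  The spaces of path classes below carry a topology that is not given by a type class, so everything is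
  phrased for abstract topologies \<open>'a topology\<close>; the library operations \<^const>\<open>joinpaths\<close>,
  \<^const>\<open>reversepath\<close> and \<^const>\<open>homotopic_paths\<close> require the class \<^class>\<open>topological_space\<close>
  and are restated here without it. Paths are functions on \<open>real\<close> that matter only on \<open>{0..1}\<close>.
\<close>

definition path_join :: "(real \<Rightarrow> 'a) \<Rightarrow> (real \<Rightarrow> 'a) \<Rightarrow> real \<Rightarrow> 'a" (infixl "\<frown>" 75)
  where "p \<frown> q = (\<lambda>t. if t \<le> 1/2 then p (2 * t) else q (2 * t - 1))"

definition path_rev :: "(real \<Rightarrow> 'a) \<Rightarrow> real \<Rightarrow> 'a"
  where "path_rev p = (\<lambda>t. p (1 - t))"

definition path_homotopic :: "'a topology \<Rightarrow> (real \<Rightarrow> 'a) \<Rightarrow> (real \<Rightarrow> 'a) \<Rightarrow> bool"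
  where "path_homotopic X p q \<longleftrightarrow>
    homotopic_with (\<lambda>r. r 0 = p 0 \<and> r 1 = p 1) (top_of_set {0..1}) X p q"

definition path_class :: "'a topology \<Rightarrow> (real \<Rightarrow> 'a) \<Rightarrow> (real \<Rightarrow> 'a) set"
  where "path_class X p = {q. path_homotopic X p q}"

definition paths_from :: "'a topology \<Rightarrow> 'a \<Rightarrow> (real \<Rightarrow> 'a) set"
  where "paths_from X x = {p. pathin X p \<and> p 0 = x}"

definition loops :: "'a topology \<Rightarrow> 'a \<Rightarrow> (real \<Rightarrow> 'a) set"
  where "loops X x = {p. pathin X p \<and> p 0 = x \<and> p 1 = x}"

definition pi1 :: "'a topology \<Rightarrow> 'a \<Rightarrow> (real \<Rightarrow> 'a) set monoid"
  where "pi1 X x =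
    \<lparr>carrier = path_class X ` loops X x,
     mult = (\<lambda>A B. {r. \<exists>p\<in>A. \<exists>q\<in>B. path_homotopic X (p \<frown> q) r}),
     one = path_class X (\<lambda>_. x)\<rparr>"

text \<open>The homomorphism of fundamental groups induced by \<open>f\<close>, with values in classes of the
  space \<open>Y\<close>: it sends \<open>[p]\<close> to \<open>[f \<circ> p]\<close>.\<close>

definition pi1_map :: "'b topology \<Rightarrow> ('a \<Rightarrow> 'b) \<Rightarrow> (real \<Rightarrow> 'a) set \<Rightarrow> (real \<Rightarrow> 'b) set"
  where "pi1_map Y f A = {r. \<exists>p\<in>A. path_homotopic Y (f \<circ> p) r}"

definition open_cover :: "'a topology \<Rightarrow> 'a set set \<Rightarrow> bool"
  where "open_cover X \<U> \<longleftrightarrow> (\<forall>U\<in>\<U>. openin X U) \<and> \<Union>\<U> = topspace X"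

definition pi1_cover :: "'a topology \<Rightarrow> 'a set set \<Rightarrow> 'a \<Rightarrow> (real \<Rightarrow> 'a) set set"
  where "pi1_cover X \<U> x = generate (pi1 X x)
    {path_class X (\<alpha> \<frown> \<gamma> \<frown> path_rev \<alpha>) | \<alpha> \<gamma>.
       \<alpha> \<in> paths_from X x \<and> \<alpha> 1 = \<gamma> 0 \<and> (\<exists>U\<in>\<U>. \<gamma> \<in> loops (subtopology X U) (\<gamma> 0))}"

definition path_equiv :: "'a topology \<Rightarrow> (real \<Rightarrow> 'a) set set \<Rightarrow> (real \<Rightarrow> 'a) \<Rightarrow> (real \<Rightarrow> 'a) \<Rightarrow> bool"
  where "path_equiv X H \<alpha> \<beta> \<longleftrightarrow> \<alpha> 1 = \<beta> 1 \<and> path_class X (\<alpha> \<frown> path_rev \<beta>) \<in> H"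

definition tilde_class ::
    "'a topology \<Rightarrow> 'a \<Rightarrow> (real \<Rightarrow> 'a) set set \<Rightarrow> (real \<Rightarrow> 'a) \<Rightarrow> (real \<Rightarrow> 'a) set"
  where "tilde_class X x0 H \<alpha> = {\<beta> \<in> paths_from X x0. path_equiv X H \<alpha> \<beta>}"

definition tilde_nbhd ::
    "'a topology \<Rightarrow> 'a \<Rightarrow> (real \<Rightarrow> 'a) set set \<Rightarrow> (real \<Rightarrow> 'a) \<Rightarrow> 'a set set \<Rightarrow> 'a set
      \<Rightarrow> (real \<Rightarrow> 'a) set set"
  where "tilde_nbhd X x0 H \<alpha> \<U> V =
    {tilde_class X x0 H \<beta> | \<beta>. \<beta> \<in> paths_from X x0 \<and>
       (\<exists>\<gamma>\<^sub>0 \<in> paths_from (subtopology X V) (\<alpha> 1). \<exists>\<delta> \<in> loops X (\<alpha> 1).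
          path_class X \<delta> \<in> pi1_cover X \<U> (\<alpha> 1) \<and> path_equiv X H \<beta> (\<alpha> \<frown> \<delta> \<frown> \<gamma>\<^sub>0))}"

text \<open>For a subgroup \<open>H\<close> the sets \<^const>\<open>tilde_nbhd\<close> form a basis, not merely a subbasis: if
  \<open>[\<gamma>]\<close> lies in \<open>tilde_nbhd X x0 H \<alpha> \<U> V\<close>, then this set equals \<open>tilde_nbhd X x0 H \<gamma> \<U> V\<close>, and
  for two covers \<open>\<U>, \<V>\<close> the sets belonging to \<open>{U \<inter> V | U V. U \<in> \<U> \<and> V \<in> \<V>}\<close> are contained
  in both. So the generated topology is the one having them as basis; every class lies in one of
  them, whence its underlying set is the set of all classes.\<close>

definition tilde_space :: "'a topology \<Rightarrow> 'a \<Rightarrow> (real \<Rightarrow> 'a) set set \<Rightarrow> (real \<Rightarrow> 'a) set topology"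
  where "tilde_space X x0 H = topology_generated_by
    {tilde_nbhd X x0 H \<alpha> \<U> V | \<alpha> \<U> V.
       open_cover X \<U> \<and> \<alpha> \<in> paths_from X x0 \<and> V \<in> \<U> \<and> \<alpha> 1 \<in> V}"

definition tilde_base :: "'a topology \<Rightarrow> 'a \<Rightarrow> (real \<Rightarrow> 'a) set set \<Rightarrow> (real \<Rightarrow> 'a) set"
  where "tilde_base X x0 H = tilde_class X x0 H (\<lambda>_. x0)"

text \<open>All members of a class share their end point, so the choice is immaterial.\<close>

definition endpoint_proj :: "(real \<Rightarrow> 'a) set \<Rightarrow> 'a"
  where "endpoint_proj c = (SOME \<alpha>. \<alpha> \<in> c) 1"

text \<open>For the trivial subgroup, \<^const>\<open>tilde_class\<close> and \<^const>\<open>path_class\<close> of a path starting at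
  \<open>x0\<close> are the same set of paths. Hence the fiber below is literally \<open>carrier (pi1 X x0)\<close>.\<close>

definition pi1_topology :: "'a topology \<Rightarrow> 'a \<Rightarrow> (real \<Rightarrow> 'a) set topology"
  where "pi1_topology X x0 =
    (let T = tilde_space X x0 {\<one>\<^bsub>pi1 X x0\<^esub>}
     in subtopology T {c \<in> topspace T. endpoint_proj c = x0})"

definition unique_path_lifting ::
    "'a topology \<Rightarrow> 'a \<Rightarrow> 'b topology \<Rightarrow> 'b \<Rightarrow> ('a \<Rightarrow> 'b) \<Rightarrow> bool"
  where "unique_path_lifting A a0 B b0 f \<longleftrightarrow>
    (\<forall>\<alpha> \<in> paths_from B b0. \<exists>\<beta> \<in> paths_from A a0. \<forall>t\<in>{0..1}. f (\<beta> t) = \<alpha> t) \<and>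
    (\<forall>\<alpha> \<in> paths_from A a0. \<forall>\<beta> \<in> paths_from A a0.
       (\<forall>t\<in>{0..1}. f (\<alpha> t) = f (\<beta> t)) \<longrightarrow> (\<forall>t\<in>{0..1}. \<alpha> t = \<beta> t))"

end

theory Submission
  imports Defs "HOL-Algebra.Zassenhaus"
begin

text \<open>
  For an open cover \<open>\<U>\<close> let \<open>K \<U> = \<pi>(\<U>, x0) G\<close>. This is a subgroup, since \<open>\<pi>(\<U>, x0)\<close> is normal, and these
  subgroups describe all neighbourhoods. A loop \<open>\<lambda>\<close> at \<open>\<alpha> 1\<close> with class in \<open>\<pi>(\<U>, \<alpha> 1)\<close> can be moved to the base point
  along \<open>\<alpha>\<close>, so the basic neighbourhood of \<open>[\<alpha>]\<close> given by \<open>\<U>\<close> and \<open>V\<close> consists of the classes of those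
  paths that are equivalent modulo \<open>K \<U>\<close> to \<open>\<alpha>\<close> followed by a path in \<open>V\<close> (\<open>tilde_class_in_nbhd_iff\<close>).
  In the fundamental group the neighbourhoods of \<open>g\<close> are the cosets \<open>\<pi>(\<U>, x0) g\<close>, whence \<open>G\<close> is closed if
  and only if it is the intersection of all \<open>K \<U>\<close> (\<open>closed_iff_Inter_saturation\<close>). Paths always have
  lifts, so unique path lifting only asks for uniqueness.

  If \<open>G\<close> is closed, lifts are unique. For two lifts \<open>t \<mapsto> [a t]\<close> and \<open>t \<mapsto> [b t]\<close> of one path and a fixed
  cover \<open>\<U>\<close>, whether \<open>a t\<close> and \<open>b t\<close> are equivalent modulo \<open>K \<U>\<close> does not change for small changes of \<open>t\<close>:
  both lifts then move along paths in one \<open>V \<in> \<U>\<close> with common end points, and two such paths differ by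
  a generator of \<open>\<pi>(\<U>, x0)\<close> (\<open>path_equiv_small\<close>). As the interval is connected, \<open>a t\<close> and \<open>b t\<close> are
  equivalent modulo every \<open>K \<U>\<close>, hence modulo \<open>G\<close> (\<open>unique_path_lifting_if_closed\<close>).

  Homotopies have lifts as well: a map from a convex set lifts by sending a point to the class of the
  image of the segment that ends there (\<open>continuous_segment_lift\<close>). If lifts of paths are unique, they
  determine this lift on the sides of the square, so a loop with null-homotopic projection is
  null-homotopic (\<open>loop_null_if_projection_null\<close>). A loop is the lift of its projection \<open>\<alpha>\<close>, and this lift
  ends at \<open>[\<alpha>]\<close>, which is the base point exactly for the classes in \<open>G\<close>. So the induced homomorphism is
  injective with image \<open>G\<close>.

  Finally, suppose that the image is \<open>G\<close>, and let the class of a loop \<open>\<alpha>\<close> belong to every \<open>K \<U>\<close>. Then the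
  end point of the lift of \<open>\<alpha>\<close> has the same neighbourhoods as the base point. Replacing the
  former by the latter turns the lift into a loop over \<open>\<alpha>\<close>, whence the class of \<open>\<alpha>\<close> belongs to the
  image. So \<open>G\<close> is closed (\<open>closed_if_image_pi1_map\<close>).
\<close>

section \<open>Homotopy of paths\<close>

abbreviation unit_interval :: "real topology"
  where "unit_interval \<equiv> top_of_set {0..1}"

abbreviation unit_square :: "(real \<times> real) topology"
  where "unit_square \<equiv> top_of_set ({0..1} \<times> {0..1})"

lemma path_homotopic_iff:
  "path_homotopic X p q \<longleftrightarrow>
    (\<exists>h. continuous_map unit_square X h
      \<and> (\<forall>t\<in>{0..1}. h (0, t) = p t \<and> h (1, t) = q t)
      \<and> (\<forall>s\<in>{0..1}. h (s, 0) = p 0 \<and> h (s, 1) = p 1))"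
proof -
  have "path_homotopic X p q \<longleftrightarrow>
    (\<exists>h. continuous_map unit_square X h
      \<and> (\<forall>t\<in>{0..1}. h (0, t) = p t) \<and> (\<forall>t\<in>{0..1}. h (1, t) = q t)
      \<and> (\<forall>s\<in>{0..1}. h (s, 0) = p 0 \<and> h (s, 1) = p 1))"
    unfolding path_homotopic_def by (subst homotopic_with) simp_all
  then show ?thesis
    by (simp only: ball_conj_distrib conj_assoc)
qed

lemma path_homotopicI:
  assumes "continuous_map unit_square X h"
    and "\<And>t. t \<in> {0..1} \<Longrightarrow> h (0, t) = p t" "\<And>t. t \<in> {0..1} \<Longrightarrow> h (1, t) = q t"
    and "\<And>s. s \<in> {0..1} \<Longrightarrow> h (s, 0) = p 0" "\<And>s. s \<in> {0..1} \<Longrightarrow> h (s, 1) = p 1"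
  shows "path_homotopic X p q"
  unfolding path_homotopic_iff using assms by blast

lemma path_homotopic_imp:
  assumes "path_homotopic X p q"
  shows "pathin X p" "pathin X q" "p 0 = q 0" "p 1 = q 1"
proof -
  show "pathin X p" "pathin X q"
    using homotopic_with_imp_continuous_maps[OF assms[unfolded path_homotopic_def]]
    by (simp_all add: pathin_def)
  show "p 0 = q 0" "p 1 = q 1"
    using homotopic_with_imp_property[OF assms[unfolded path_homotopic_def]] by simp_all
qed

lemma path_homotopic_refl: "pathin X p \<Longrightarrow> path_homotopic X p p"
  by (simp add: path_homotopic_def pathin_def)

lemma path_homotopic_sym:
  assumes "path_homotopic X p q"
  shows "path_homotopic X q p"
  using homotopic_with_symD[OF assms[unfolded path_homotopic_def]] path_homotopic_imp(3,4)[OF assms]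
  by (simp add: path_homotopic_def)

lemma path_homotopic_trans:
  assumes "path_homotopic X p q" "path_homotopic X q r"
  shows "path_homotopic X p r"
  using homotopic_with_trans[OF assms(1)[unfolded path_homotopic_def]] assms(2) path_homotopic_imp(3,4)[OF assms(1)]
  by (simp add: path_homotopic_def)

lemma path_homotopic_if_eq_on:
  assumes "pathin X p" "\<And>t. t \<in> {0..1} \<Longrightarrow> p t = q t"
  shows "path_homotopic X p q"
  unfolding path_homotopic_def
  using assms by (intro homotopic_with_equal) (auto simp: pathin_def)

lemma pathin_join:
  assumes "pathin X p" "pathin X q" "p 1 = q 0"
  shows "pathin X (p \<frown> q)"
  unfolding pathin_def path_join_def
proof (rule continuous_map_cases_le)
  have "continuous_map (subtopology unit_interval {x \<in> topspace unit_interval. x \<le> 1/2}) X (p \<circ> (\<lambda>t. 2 * t))"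
    using assms(1) unfolding pathin_def
    by (rule continuous_map_compose[rotated]) (auto simp: subtopology_subtopology intro!: continuous_intros)
  then show "continuous_map (subtopology unit_interval {x \<in> topspace unit_interval. x \<le> 1/2}) X (\<lambda>t. p (2 * t))"
    by (simp add: o_def)
  have "continuous_map (subtopology unit_interval {x \<in> topspace unit_interval. 1/2 \<le> x}) X (q \<circ> (\<lambda>t. 2 * t - 1))"
    using assms(2) unfolding pathin_def
    by (rule continuous_map_compose[rotated]) (auto simp: subtopology_subtopology intro!: continuous_intros)
  then show "continuous_map (subtopology unit_interval {x \<in> topspace unit_interval. 1/2 \<le> x}) X (\<lambda>t. q (2 * t - 1))"
    by (simp add: o_def)
next
  fix x :: real
  assume "x = 1/2"
  then have "2 * x = 1" by simp
  then show "p (2 * x) = q (2 * x - 1)" using assms(3) by simp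
qed auto

lemma pathin_rev:
  assumes "pathin X p"
  shows "pathin X (path_rev p)"
proof -
  have "continuous_map unit_interval X (p \<circ> (\<lambda>t. 1 - t))"
    using assms unfolding pathin_def
    by (rule continuous_map_compose[rotated]) (auto intro!: continuous_intros)
  then show ?thesis by (simp add: pathin_def path_rev_def o_def)
qed

lemma path_ends [simp]:
  "(p \<frown> q) 0 = p 0" "(p \<frown> q) 1 = q 1" "path_rev p 0 = p 1" "path_rev p 1 = p 0"
  by (simp_all add: path_join_def path_rev_def)

lemma path_rev_rev [simp]: "path_rev (path_rev p) = p"
  by (simp add: path_rev_def)

lemma path_rev_const [simp]: "path_rev (\<lambda>_. x) = (\<lambda>_. x)"
  by (simp add: path_rev_def)

lemma path_rev_join:
  assumes "p 1 = q 0"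
  shows "path_rev (p \<frown> q) = path_rev q \<frown> path_rev p"
proof
  fix t :: real
  show "path_rev (p \<frown> q) t = (path_rev q \<frown> path_rev p) t"
    by (cases "t = 1/2") (use assms in \<open>auto simp: path_rev_def path_join_def algebra_simps\<close>)
qed

lemma comp_path_join: "f \<circ> (p \<frown> q) = (f \<circ> p) \<frown> (f \<circ> q)"
  by (auto simp: path_join_def)

lemma path_homotopic_join:
  assumes "path_homotopic X p p'" "path_homotopic X q q'" "p 1 = q 0"
  shows "path_homotopic X (p \<frown> q) (p' \<frown> q')"
proof -
  obtain h where h: "continuous_map unit_square X h"
    "\<forall>t\<in>{0..1}. h (0, t) = p t \<and> h (1, t) = p' t"
    "\<forall>s\<in>{0..1}. h (s, 0) = p 0 \<and> h (s, 1) = p 1"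
    using assms(1) unfolding path_homotopic_iff by blast
  obtain k where k: "continuous_map unit_square X k"
    "\<forall>t\<in>{0..1}. k (0, t) = q t \<and> k (1, t) = q' t"
    "\<forall>s\<in>{0..1}. k (s, 0) = q 0 \<and> k (s, 1) = q 1"
    using assms(2) unfolding path_homotopic_iff by blast
  have "continuous_map unit_square X (\<lambda>z. if snd z \<le> 1/2 then (h \<circ> (\<lambda>z. (fst z, 2 * snd z))) z
          else (k \<circ> (\<lambda>z. (fst z, 2 * snd z - 1))) z)"
  proof (rule continuous_map_cases_le)
    show "continuous_map (subtopology unit_square {x \<in> topspace unit_square. snd x \<le> 1/2}) X (h \<circ> (\<lambda>z. (fst z, 2 * snd z)))"
      using h(1) by (rule continuous_map_compose[rotated])
        (auto simp: subtopology_subtopology intro!: continuous_intros)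
    show "continuous_map (subtopology unit_square {x \<in> topspace unit_square. 1/2 \<le> snd x}) X (k \<circ> (\<lambda>z. (fst z, 2 * snd z - 1)))"
      using k(1) by (rule continuous_map_compose[rotated])
        (auto simp: subtopology_subtopology intro!: continuous_intros)
  next
    fix z :: "real \<times> real"
    assume "z \<in> topspace unit_square" "snd z = 1/2"
    then have "fst z \<in> {0..1}" "2 * snd z = 1" by auto
    then show "(h \<circ> (\<lambda>z. (fst z, 2 * snd z))) z = (k \<circ> (\<lambda>z. (fst z, 2 * snd z - 1))) z"
      using assms(3) h(3) k(3) by (simp del: atLeastAtMost_iff)
  qed (auto intro!: continuous_intros)
  then show ?thesis
    by (rule path_homotopicI) (auto simp: path_join_def h k)
qed

lemma path_homotopic_comp:
  assumes "path_homotopic X p q" "continuous_map X Y f"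
  shows "path_homotopic Y (f \<circ> p) (f \<circ> q)"
  using assms unfolding path_homotopic_def
  by (auto intro: homotopic_with_compose_continuous_map_left)

text \<open>Straight-line homotopies in a convex set are pushed forward along \<open>f\<close>. The groupoid
  laws below arise from suitable \<open>p\<close> and \<open>q\<close> in the unit interval, and the continuity of lifted maps
  from segments.\<close>

lemma path_homotopic_convex_image:
  fixes C :: "'b::real_normed_vector set"
  assumes "convex C" "continuous_map (top_of_set C) X f"
    and "path p" "path_image p \<subseteq> C" "path q" "path_image q \<subseteq> C"
    and "p 0 = q 0" "p 1 = q 1"
  shows "path_homotopic X (f \<circ> p) (f \<circ> q)"
proof -
  have C: "(1 - s) *\<^sub>R p t + s *\<^sub>R q t \<in> C" if "s \<in> {0..1}" "t \<in> {0..1}" for s t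
  proof -
    have "p t \<in> C" "q t \<in> C"
      using assms(4,6) that(2) by (auto simp: path_image_def)
    then show ?thesis
      using convexD_alt[OF assms(1)] that(1) by simp
  qed
  have "continuous_on ({0..1} \<times> {0..1}) (\<lambda>z. r (snd z))" if "path r" for r :: "real \<Rightarrow> 'b"
    using that unfolding path_def
    by (rule continuous_on_compose2[OF _ continuous_on_snd[OF continuous_on_id]]) auto
  from this[OF assms(3)] this[OF assms(5)]
  have "continuous_on ({0..1} \<times> {0..1}) (\<lambda>z. (1 - fst z) *\<^sub>R p (snd z) + fst z *\<^sub>R q (snd z))"
    by (intro continuous_intros) auto
  with C have "continuous_map unit_square (top_of_set C)
      (\<lambda>z. (1 - fst z) *\<^sub>R p (snd z) + fst z *\<^sub>R q (snd z))"
    by auto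
  then have "continuous_map unit_square X
      (f \<circ> (\<lambda>z. (1 - fst z) *\<^sub>R p (snd z) + fst z *\<^sub>R q (snd z)))"
    using assms(2) by (rule continuous_map_compose)
  then show ?thesis
    by (rule path_homotopicI) (auto simp: assms(7,8) scaleR_left_distrib[symmetric])
qed

lemma path_join_eq_joinpaths: "p \<frown> q = p +++ q"
  by (simp add: path_join_def joinpaths_def)

lemma path_homotopic_reparam:
  assumes "pathin X f" "path p" "path_image p \<subseteq> {0..1}" "path q" "path_image q \<subseteq> {0..1}"
    and "p 0 = q 0" "p 1 = q 1"
  shows "path_homotopic X (f \<circ> p) (f \<circ> q)"
  using assms by (intro path_homotopic_convex_image[where C="{0..1}"]) (simp_all add: pathin_def)

lemma comp_linepath_01 [simp]: "p \<circ> linepath 0 1 = p" "p \<circ> linepath 1 0 = path_rev p"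
  by (simp_all add: linepath_def fun_eq_iff path_rev_def)

lemma comp_linepath_refl [simp]: "p \<circ> linepath a a = (\<lambda>_. p a)"
  by (simp add: linepath_refl o_def)

text \<open>Both sides are \<open>(p \<frown> q) \<frown> r\<close> composed with a piecewise linear map of the interval.\<close>

lemma path_homotopic_assoc:
  assumes "pathin X p" "pathin X q" "pathin X r" "p 1 = q 0" "q 1 = r 0"
  shows "path_homotopic X ((p \<frown> q) \<frown> r) (p \<frown> (q \<frown> r))"
proof -
  let ?\<phi> = "linepath 0 (1/4) \<frown> (linepath (1/4) (1/2) \<frown> linepath (1/2) (1::real))"
  have "path_homotopic X (((p \<frown> q) \<frown> r) \<circ> linepath 0 1) (((p \<frown> q) \<frown> r) \<circ> ?\<phi>)"
  proof (rule path_homotopic_reparam)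
    show "pathin X ((p \<frown> q) \<frown> r)"
      using assms by (intro pathin_join) simp_all
    show "path ?\<phi>" "path_image ?\<phi> \<subseteq> {0..1}"
      by (auto simp: path_join_eq_joinpaths path_image_join closed_segment_eq_real_ivl)
    show "path (linepath 0 (1::real))" "path_image (linepath 0 (1::real)) \<subseteq> {0..1}"
      by (simp_all only: path_linepath path_image_linepath closed_segment_eq_real_ivl) simp
  qed (simp_all add: linepath_def)
  moreover have "((p \<frown> q) \<frown> r) \<circ> ?\<phi> = p \<frown> (q \<frown> r)"
    by (auto simp: path_join_def linepath_def fun_eq_iff field_simps)
      (auto intro!: arg_cong[where f=q] arg_cong[where f=r] simp: field_simps)
  ultimately show ?thesis by simp
qed

lemma path_homotopic_units:
  assumes "pathin X p"
  shows "path_homotopic X (p \<frown> (\<lambda>_. p 1)) p" "path_homotopic X ((\<lambda>_. p 0) \<frown> p) p"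
proof -
  have "path_homotopic X (p \<circ> (linepath 0 1 \<frown> linepath 1 1)) (p \<circ> linepath 0 1)"
    using assms
    by (rule path_homotopic_reparam)
      (auto simp: path_join_eq_joinpaths path_image_join closed_segment_eq_real_ivl,
        simp_all add: joinpaths_def linepath_def)
  then show "path_homotopic X (p \<frown> (\<lambda>_. p 1)) p"
    by (simp add: comp_path_join)
  have "path_homotopic X (p \<circ> (linepath 0 0 \<frown> linepath 0 1)) (p \<circ> linepath 0 1)"
    using assms
    by (rule path_homotopic_reparam)
      (auto simp: path_join_eq_joinpaths path_image_join closed_segment_eq_real_ivl,
        simp_all add: joinpaths_def linepath_def)
  then show "path_homotopic X ((\<lambda>_. p 0) \<frown> p) p"
    by (simp add: comp_path_join)
qed

lemma path_homotopic_inverse: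
  assumes "pathin X p"
  shows "path_homotopic X (p \<frown> path_rev p) (\<lambda>_. p 0)"
proof -
  have "path_homotopic X (p \<circ> (linepath 0 1 \<frown> linepath 1 0)) (p \<circ> linepath 0 0)"
    using assms
    by (rule path_homotopic_reparam)
      (auto simp: path_join_eq_joinpaths path_image_join closed_segment_eq_real_ivl,
        simp_all add: joinpaths_def linepath_def)
  then show ?thesis
    by (simp add: comp_path_join)
qed

section \<open>Calculus of path classes\<close>

text \<open>Composition of homotopy classes of paths with arbitrary end points. Joining only pairs of
  genuine paths that meet makes this operation associative on all sets of functions, so that
  identities in the fundamental groupoid become rewrite rules.\<close>

definition class_join ::
    "'a topology \<Rightarrow> (real \<Rightarrow> 'a) set \<Rightarrow> (real \<Rightarrow> 'a) set \<Rightarrow> (real \<Rightarrow> 'a) set"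
  where "class_join X A B =
    {r. \<exists>p\<in>A. \<exists>q\<in>B. pathin X p \<and> pathin X q \<and> p 1 = q 0 \<and> path_homotopic X (p \<frown> q) r}"

lemma path_class_eq:
  assumes "path_homotopic X p q"
  shows "path_class X p = path_class X q"
proof -
  have "path_homotopic X p r \<longleftrightarrow> path_homotopic X q r" for r
    using path_homotopic_trans[OF assms, of r] path_homotopic_trans[OF path_homotopic_sym[OF assms], of r] by blast
  then show ?thesis
    by (simp add: path_class_def)
qed

lemma path_class_self: "pathin X p \<Longrightarrow> p \<in> path_class X p"
  by (simp add: path_class_def path_homotopic_refl)

lemma path_class_eqD:
  assumes "path_class X p = path_class X q" "pathin X q"
  shows "path_homotopic X p q"
  using path_class_self[OF assms(2)] unfolding assms(1)[symmetric] by (simp add: path_class_def)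

lemma path_class_join:
  assumes "pathin X p" "pathin X q" "p 1 = q 0"
  shows "path_class X (p \<frown> q) = class_join X (path_class X p) (path_class X q)"
proof (intro equalityI subsetI)
  fix r assume "r \<in> path_class X (p \<frown> q)"
  then show "r \<in> class_join X (path_class X p) (path_class X q)"
    using assms path_homotopic_refl unfolding class_join_def path_class_def by blast
next
  fix r assume "r \<in> class_join X (path_class X p) (path_class X q)"
  then obtain p' q' where "path_homotopic X p p'" "path_homotopic X q q'"
      "path_homotopic X (p' \<frown> q') r"
    unfolding class_join_def path_class_def by blast
  moreover from this have "path_homotopic X (p \<frown> q) (p' \<frown> q')"
    using assms by (intro path_homotopic_join)
  ultimately show "r \<in> path_class X (p \<frown> q)"
    unfolding path_class_def using path_homotopic_trans by blast
qed

text \<open>Members of either side are homotopic to a concatenation of three paths that meet; the homotopy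
  between its two bracketings does the rest.\<close>

lemma class_join_assoc: "class_join X (class_join X A B) C = class_join X A (class_join X B C)"
proof (intro equalityI subsetI)
  fix r assume "r \<in> class_join X (class_join X A B) C"
  then obtain a b s c where "a \<in> A" "b \<in> B" "c \<in> C" "pathin X a" "pathin X b" "pathin X c"
      "a 1 = b 0" "s 1 = c 0" and s: "path_homotopic X (a \<frown> b) s" and r: "path_homotopic X (s \<frown> c) r"
    unfolding class_join_def by blast
  moreover have "b 1 = c 0"
    using path_homotopic_imp(4)[OF s] \<open>s 1 = c 0\<close> by simp
  moreover have "path_homotopic X (s \<frown> c) ((a \<frown> b) \<frown> c)"
    using path_homotopic_sym[OF s] path_homotopic_refl[OF \<open>pathin X c\<close>] \<open>s 1 = c 0\<close>
    by (rule path_homotopic_join)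
  ultimately have "path_homotopic X (a \<frown> (b \<frown> c)) r"
    using path_homotopic_assoc[of X a b c] by (meson path_homotopic_sym path_homotopic_trans)
  moreover have "b \<frown> c \<in> class_join X B C" "pathin X (b \<frown> c)"
    using pathin_join[of X b c] path_homotopic_refl[of X "b \<frown> c"] \<open>b \<in> B\<close> \<open>c \<in> C\<close> \<open>pathin X b\<close>
      \<open>pathin X c\<close> \<open>b 1 = c 0\<close> unfolding class_join_def by blast+
  ultimately show "r \<in> class_join X A (class_join X B C)"
    using \<open>a \<in> A\<close> \<open>pathin X a\<close> \<open>a 1 = b 0\<close> unfolding class_join_def[of X A] by force
next
  fix r assume "r \<in> class_join X A (class_join X B C)"
  then obtain a b s c where "a \<in> A" "b \<in> B" "c \<in> C" "pathin X a" "pathin X b" "pathin X c"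
      "b 1 = c 0" "a 1 = s 0" and s: "path_homotopic X (b \<frown> c) s" and r: "path_homotopic X (a \<frown> s) r"
    unfolding class_join_def by blast
  moreover have "a 1 = b 0"
    using path_homotopic_imp(3)[OF s] \<open>a 1 = s 0\<close> by simp
  moreover have "path_homotopic X (a \<frown> s) (a \<frown> (b \<frown> c))"
    using path_homotopic_refl[OF \<open>pathin X a\<close>] path_homotopic_sym[OF s] \<open>a 1 = s 0\<close>
    by (rule path_homotopic_join)
  ultimately have "path_homotopic X ((a \<frown> b) \<frown> c) r"
    using path_homotopic_assoc[of X a b c] by (meson path_homotopic_sym path_homotopic_trans)
  moreover have "a \<frown> b \<in> class_join X A B" "pathin X (a \<frown> b)"
    using pathin_join[of X a b] path_homotopic_refl[of X "a \<frown> b"] \<open>a \<in> A\<close> \<open>b \<in> B\<close> \<open>pathin X a\<close>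
      \<open>pathin X b\<close> \<open>a 1 = b 0\<close> unfolding class_join_def by blast+
  ultimately show "r \<in> class_join X (class_join X A B) C"
    using \<open>c \<in> C\<close> \<open>pathin X c\<close> \<open>b 1 = c 0\<close> unfolding class_join_def[of X "class_join X A B"] by force
qed

lemma class_join_unit_left:
  assumes "pathin X p" "p 0 = x"
  shows "class_join X (path_class X (\<lambda>_. x)) (path_class X p) = path_class X p"
proof -
  have "x \<in> topspace X"
    using assms by (force simp: pathin_def continuous_map_def)
  then have "pathin X (\<lambda>_. x)" by simp
  then have "class_join X (path_class X (\<lambda>_. x)) (path_class X p) = path_class X ((\<lambda>_. x) \<frown> p)"
    using assms by (intro path_class_join[symmetric]) simp_all
  also have "\<dots> = path_class X p"
    using path_class_eq[OF path_homotopic_units(2)[OF assms(1)]] assms(2) by simp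
  finally show ?thesis .
qed

lemma class_join_unit_right:
  assumes "pathin X p" "p 1 = x"
  shows "class_join X (path_class X p) (path_class X (\<lambda>_. x)) = path_class X p"
proof -
  have "x \<in> topspace X"
    using assms by (force simp: pathin_def continuous_map_def)
  then have "pathin X (\<lambda>_. x)" by simp
  then have "class_join X (path_class X p) (path_class X (\<lambda>_. x)) = path_class X (p \<frown> (\<lambda>_. x))"
    using assms by (intro path_class_join[symmetric]) simp_all
  also have "\<dots> = path_class X p"
    using path_class_eq[OF path_homotopic_units(1)[OF assms(1)]] assms(2) by simp
  finally show ?thesis .
qed

lemma class_join_inverse:
  assumes "pathin X p"
  shows "class_join X (path_class X p) (path_class X (path_rev p)) = path_class X (\<lambda>_. p 0)"
proof -
  have "class_join X (path_class X p) (path_class X (path_rev p)) = path_class X (p \<frown> path_rev p)"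
    using assms by (intro path_class_join[symmetric]) (simp_all add: pathin_rev)
  then show ?thesis
    using path_class_eq[OF path_homotopic_inverse[OF assms]] by simp
qed

lemma class_join_inverse':
  assumes "pathin X p"
  shows "class_join X (path_class X (path_rev p)) (path_class X p) = path_class X (\<lambda>_. p 1)"
  using class_join_inverse[OF pathin_rev[OF assms]] by simp

text \<open>Once composition is associated to the right, a path and its reverse are neighbours only with
  something following them. The rules with \<open>C\<close> cover a longer continuation.\<close>

lemma class_join_cancel:
  assumes "pathin X p"
  shows "pathin X q \<Longrightarrow> q 0 = p 0 \<Longrightarrow>
      class_join X (path_class X p) (class_join X (path_class X (path_rev p)) (path_class X q)) = path_class X q"
    and "pathin X q \<Longrightarrow> q 0 = p 0 \<Longrightarrow>
      class_join X (path_class X p) (class_join X (path_class X (path_rev p)) (class_join X (path_class X q) C))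
        = class_join X (path_class X q) C"
    and "pathin X q \<Longrightarrow> q 0 = p 1 \<Longrightarrow>
      class_join X (path_class X (path_rev p)) (class_join X (path_class X p) (path_class X q)) = path_class X q"
    and "pathin X q \<Longrightarrow> q 0 = p 1 \<Longrightarrow>
      class_join X (path_class X (path_rev p)) (class_join X (path_class X p) (class_join X (path_class X q) C))
        = class_join X (path_class X q) C"
  using assms by (simp_all add: class_join_inverse class_join_inverse' class_join_unit_left flip: class_join_assoc)

lemma class_join_unit_cont:
  "pathin X p \<Longrightarrow> p 0 = x \<Longrightarrow>
    class_join X (path_class X (\<lambda>_. x)) (class_join X (path_class X p) C) = class_join X (path_class X p) C"
  "pathin X p \<Longrightarrow> p 1 = x \<Longrightarrow>
    class_join X (path_class X p) (class_join X (path_class X (\<lambda>_. x)) C) = class_join X (path_class X p) C"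
  by (simp_all add: class_join_unit_left class_join_unit_right flip: class_join_assoc)

text \<open>Rewriting with these rules decides identities between concatenations: the class of a
  concatenation is broken up into the classes of its pieces, associated to the right, and reduced like
  a word in a free groupoid. The end points of the pieces must be available as equations.\<close>

lemmas path_class_simps =
  path_class_join pathin_join pathin_rev path_rev_join class_join_assoc
  class_join_unit_left class_join_unit_right class_join_unit_cont
  class_join_inverse class_join_inverse' class_join_cancel

section \<open>The fundamental group\<close>

lemma pi1_simps [simp]:
  "carrier (pi1 X x) = path_class X ` loops X x" "\<one>\<^bsub>pi1 X x\<^esub> = path_class X (\<lambda>_. x)"
  by (simp_all add: pi1_def)

lemma path_class_loops: "p \<in> loops X x \<Longrightarrow> q \<in> path_class X p \<Longrightarrow> q \<in> loops X x"
  using path_homotopic_imp[of X p q] by (auto simp: loops_def path_class_def)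

lemma mult_pi1:
  assumes "p \<in> loops X x" "q \<in> loops X x"
  shows "path_class X p \<otimes>\<^bsub>pi1 X x\<^esub> path_class X q = class_join X (path_class X p) (path_class X q)"
proof -
  have "pathin X p' \<and> pathin X q' \<and> p' 1 = q' 0" if "p' \<in> path_class X p" "q' \<in> path_class X q" for p' q'
    using path_class_loops[OF assms(1) that(1)] path_class_loops[OF assms(2) that(2)]
    by (simp add: loops_def)
  then show ?thesis
    unfolding pi1_def class_join_def by auto
qed

lemma loops_closed [simp]:
  "x \<in> topspace X \<Longrightarrow> (\<lambda>_. x) \<in> loops X x"
  "p \<in> loops X x \<Longrightarrow> path_rev p \<in> loops X x"
  "p \<in> loops X x \<Longrightarrow> q \<in> loops X x \<Longrightarrow> p \<frown> q \<in> loops X x"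
  by (simp_all add: loops_def pathin_rev pathin_join)

lemma mult_pi1_join:
  assumes "p \<in> loops X x" "q \<in> loops X x"
  shows "path_class X p \<otimes>\<^bsub>pi1 X x\<^esub> path_class X q = path_class X (p \<frown> q)"
  using assms by (simp add: mult_pi1 path_class_join loops_def)

lemma group_pi1:
  assumes "x \<in> topspace X"
  shows "group (pi1 X x)"
proof (rule groupI)
  show "\<one>\<^bsub>pi1 X x\<^esub> \<in> carrier (pi1 X x)"
    using assms by simp
next
  fix A B assume "A \<in> carrier (pi1 X x)" "B \<in> carrier (pi1 X x)"
  then show "A \<otimes>\<^bsub>pi1 X x\<^esub> B \<in> carrier (pi1 X x)"
    by (auto simp: mult_pi1_join)
next
  fix A B C
  assume "A \<in> carrier (pi1 X x)" "B \<in> carrier (pi1 X x)" "C \<in> carrier (pi1 X x)"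
  then obtain p q r where "A = path_class X p" "B = path_class X q" "C = path_class X r"
      "p \<in> loops X x" "q \<in> loops X x" "r \<in> loops X x"
    by auto
  then show "A \<otimes>\<^bsub>pi1 X x\<^esub> B \<otimes>\<^bsub>pi1 X x\<^esub> C = A \<otimes>\<^bsub>pi1 X x\<^esub> (B \<otimes>\<^bsub>pi1 X x\<^esub> C)"
    by (simp add: mult_pi1_join) (simp add: loops_def path_class_simps)
next
  fix A assume "A \<in> carrier (pi1 X x)"
  then obtain p where p: "A = path_class X p" "p \<in> loops X x"
    by auto
  then show "\<one>\<^bsub>pi1 X x\<^esub> \<otimes>\<^bsub>pi1 X x\<^esub> A = A"
    using assms by (simp add: mult_pi1) (simp add: loops_def path_class_simps)
  have "path_class X (path_rev p) \<otimes>\<^bsub>pi1 X x\<^esub> A = \<one>\<^bsub>pi1 X x\<^esub>"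
    using p by (simp add: mult_pi1) (simp add: loops_def path_class_simps)
  then show "\<exists>B\<in>carrier (pi1 X x). B \<otimes>\<^bsub>pi1 X x\<^esub> A = \<one>\<^bsub>pi1 X x\<^esub>"
    using p by auto
qed

lemma inv_pi1:
  assumes "p \<in> loops X x"
  shows "inv\<^bsub>pi1 X x\<^esub> (path_class X p) = path_class X (path_rev p)"
proof -
  have "x \<in> topspace X"
    using assms by (force simp: loops_def pathin_def continuous_map_def)
  then interpret group "pi1 X x" by (rule group_pi1)
  show ?thesis
  proof (rule inv_equality)
    show "path_class X (path_rev p) \<otimes>\<^bsub>pi1 X x\<^esub> path_class X p = \<one>\<^bsub>pi1 X x\<^esub>"
      using assms by (simp add: mult_pi1) (simp add: loops_def class_join_inverse')
  qed (use assms in simp_all)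
qed

lemma pi1_map_path_class:
  assumes "continuous_map X Y f" "pathin X p"
  shows "pi1_map Y f (path_class X p) = path_class Y (f \<circ> p)"
proof -
  have "path_class Y (f \<circ> q) = path_class Y (f \<circ> p)" if "q \<in> path_class X p" for q
    using path_class_eq[OF path_homotopic_comp[OF _ assms(1), of p q]] that by (simp add: path_class_def)
  then have "(\<Union>q\<in>path_class X p. path_class Y (f \<circ> q)) = (\<Union>q\<in>path_class X p. path_class Y (f \<circ> p))"
    by (rule SUP_cong[OF refl])
  moreover have "p \<in> path_class X p"
    using assms(2) by (rule path_class_self)
  moreover have "pi1_map Y f (path_class X p) = (\<Union>q\<in>path_class X p. path_class Y (f \<circ> q))"
    by (auto simp: pi1_map_def path_class_def)
  ultimately show ?thesis
    by auto
qed

lemma pi1_map_hom: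
  assumes "continuous_map X Y f" "f x = y"
  shows "pi1_map Y f \<in> hom (pi1 X x) (pi1 Y y)"
proof (rule homI)
  have loops: "f \<circ> p \<in> loops Y y" if "p \<in> loops X x" for p
    using that assms pathin_compose[of X p Y f] by (simp add: loops_def)
  fix A assume "A \<in> carrier (pi1 X x)"
  then obtain p where p: "A = path_class X p" "p \<in> loops X x"
    by auto
  then show "pi1_map Y f A \<in> carrier (pi1 Y y)"
    using loops assms(1) by (auto simp: pi1_map_path_class loops_def)
  fix B assume "B \<in> carrier (pi1 X x)"
  then obtain q where q: "B = path_class X q" "q \<in> loops X x"
    by auto
  have "pathin X p" "pathin X q" "pathin X (p \<frown> q)"
    using p(2) q(2) loops_closed(3)[OF p(2) q(2)] by (simp_all add: loops_def)
  then show "pi1_map Y f (A \<otimes>\<^bsub>pi1 X x\<^esub> B) = pi1_map Y f A \<otimes>\<^bsub>pi1 Y y\<^esub> pi1_map Y f B"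
    using p q loops assms(1) by (simp add: mult_pi1_join pi1_map_path_class comp_path_join)
qed

section \<open>Subgroups attached to open covers\<close>

lemma pi1_cover_generator_loop:
  assumes "\<alpha> \<in> paths_from X x" "\<alpha> 1 = \<gamma> 0" "\<gamma> \<in> loops (subtopology X U) (\<gamma> 0)"
  shows "\<alpha> \<frown> \<gamma> \<frown> path_rev \<alpha> \<in> loops X x"
  using assms by (auto simp: paths_from_def loops_def pathin_subtopology intro!: pathin_join pathin_rev)

lemma pi1_cover_generator:
  assumes "\<alpha> \<in> paths_from X x" "\<alpha> 1 = \<gamma> 0" "U \<in> \<U>" "\<gamma> \<in> loops (subtopology X U) (\<gamma> 0)"
  shows "path_class X (\<alpha> \<frown> \<gamma> \<frown> path_rev \<alpha>) \<in> pi1_cover X \<U> x"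
  unfolding pi1_cover_def
  by (rule generate.incl, rule CollectI, rule exI[of _ \<alpha>], rule exI[of _ \<gamma>]) (use assms in blast)

lemma subgroup_pi1_cover:
  assumes "x \<in> topspace X"
  shows "subgroup (pi1_cover X \<U> x) (pi1 X x)"
  unfolding pi1_cover_def
proof (rule group.generate_is_subgroup[OF group_pi1[OF assms]])
  show "{path_class X (\<alpha> \<frown> \<gamma> \<frown> path_rev \<alpha>) | \<alpha> \<gamma>.
       \<alpha> \<in> paths_from X x \<and> \<alpha> 1 = \<gamma> 0 \<and> (\<exists>U\<in>\<U>. \<gamma> \<in> loops (subtopology X U) (\<gamma> 0))} \<subseteq> carrier (pi1 X x)"
    using pi1_cover_generator_loop[of _ X x] by auto
qed

lemma path_end_in_topspace:
  assumes "pathin X p"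
  shows "p 0 \<in> topspace X" "p 1 \<in> topspace X"
  using assms by (auto simp: pathin_def continuous_map_def Pi_iff)

text \<open>Change of base point along \<open>\<alpha>\<close> is a homomorphism and carries the generator for \<open>\<gamma>\<close> and \<open>\<beta>\<close> to the
  generator for \<open>\<gamma>\<close> and \<open>\<alpha> \<frown> \<beta>\<close>. The statement about some representative is the one that an induction
  over the generated subgroup can prove.\<close>

lemma pi1_cover_transport_ex:
  assumes "\<alpha> \<in> paths_from X y" "\<alpha> 1 = x" "A \<in> pi1_cover X \<U> x"
  shows "\<exists>\<delta>\<in>loops X x. A = path_class X \<delta> \<and> path_class X (\<alpha> \<frown> \<delta> \<frown> path_rev \<alpha>) \<in> pi1_cover X \<U> y"
proof -
  have \<alpha>: "pathin X \<alpha>" "\<alpha> 0 = y" "\<alpha> 1 = x"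
    using assms by (simp_all add: paths_from_def)
  then have top: "x \<in> topspace X" "y \<in> topspace X"
    using path_end_in_topspace by blast+
  interpret S: subgroup "pi1_cover X \<U> y" "pi1 X y"
    using top(2) by (rule subgroup_pi1_cover)
  interpret group "pi1 X y"
    using top(2) by (rule group_pi1)
  have loop: "\<alpha> \<frown> \<delta> \<frown> path_rev \<alpha> \<in> loops X y" if "\<delta> \<in> loops X x" for \<delta>
    using that \<alpha> by (simp add: loops_def pathin_join pathin_rev)
  have generator: "\<exists>\<delta>\<in>loops X x. h = path_class X \<delta> \<and> path_class X (\<alpha> \<frown> \<delta> \<frown> path_rev \<alpha>) \<in> pi1_cover X \<U> y"
    if h: "h \<in> {path_class X (\<beta> \<frown> \<gamma> \<frown> path_rev \<beta>) | \<beta> \<gamma>.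
       \<beta> \<in> paths_from X x \<and> \<beta> 1 = \<gamma> 0 \<and> (\<exists>U\<in>\<U>. \<gamma> \<in> loops (subtopology X U) (\<gamma> 0))}" for h
  proof -
    obtain \<beta> \<gamma> U where h: "h = path_class X (\<beta> \<frown> \<gamma> \<frown> path_rev \<beta>)" "\<beta> \<in> paths_from X x" "\<beta> 1 = \<gamma> 0"
        "U \<in> \<U>" "\<gamma> \<in> loops (subtopology X U) (\<gamma> 0)"
      using h by blast
    have paths: "pathin X \<beta>" "\<beta> 0 = x" "pathin X \<gamma>" "\<gamma> 1 = \<gamma> 0"
      using h by (simp_all add: paths_from_def loops_def pathin_subtopology)
    have "\<alpha> \<frown> \<beta> \<in> paths_from X y"
      using \<alpha> paths by (simp add: paths_from_def pathin_join)
    then have "path_class X ((\<alpha> \<frown> \<beta>) \<frown> \<gamma> \<frown> path_rev (\<alpha> \<frown> \<beta>)) \<in> pi1_cover X \<U> y"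
      using h(3-5) by (intro pi1_cover_generator) simp_all
    also have "path_class X ((\<alpha> \<frown> \<beta>) \<frown> \<gamma> \<frown> path_rev (\<alpha> \<frown> \<beta>))
        = path_class X (\<alpha> \<frown> (\<beta> \<frown> \<gamma> \<frown> path_rev \<beta>) \<frown> path_rev \<alpha>)"
      using \<alpha> paths h(3) by (simp add: path_class_simps)
    finally show ?thesis
      using h(1) pi1_cover_generator_loop[OF h(2,3,5)] by blast
  qed
  show ?thesis
    using assms(3) unfolding pi1_cover_def[of X \<U> x]
  proof (induction rule: generate.induct)
    case one
    have "path_class X (\<alpha> \<frown> (\<lambda>_. x) \<frown> path_rev \<alpha>) = \<one>\<^bsub>pi1 X y\<^esub>"
      using \<alpha> top by (simp add: path_class_simps)
    then have "path_class X (\<alpha> \<frown> (\<lambda>_. x) \<frown> path_rev \<alpha>) \<in> pi1_cover X \<U> y"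
      using S.one_closed by (simp only:)
    then show ?case
      using top(1) by (intro bexI[of _ "\<lambda>_. x"]) simp_all
  next
    case (incl h)
    then show ?case by (rule generator)
  next
    case (inv h)
    then obtain \<delta> where \<delta>: "\<delta> \<in> loops X x" "h = path_class X \<delta>"
        "path_class X (\<alpha> \<frown> \<delta> \<frown> path_rev \<alpha>) \<in> pi1_cover X \<U> y"
      using generator by blast
    have "inv\<^bsub>pi1 X y\<^esub> (path_class X (\<alpha> \<frown> \<delta> \<frown> path_rev \<alpha>)) = path_class X (path_rev (\<alpha> \<frown> \<delta> \<frown> path_rev \<alpha>))"
      using loop[OF \<delta>(1)] by (rule inv_pi1)
    also have "\<dots> = path_class X (\<alpha> \<frown> path_rev \<delta> \<frown> path_rev \<alpha>)"
      using \<alpha> \<delta>(1) by (simp add: loops_def path_class_simps)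
    finally show ?case
      using \<delta> S.m_inv_closed[OF \<delta>(3)] inv_pi1[OF \<delta>(1)] by (intro bexI[of _ "path_rev \<delta>"]) auto
  next
    case (eng A B)
    then obtain \<delta> \<epsilon> where \<delta>: "\<delta> \<in> loops X x" "A = path_class X \<delta>"
        "path_class X (\<alpha> \<frown> \<delta> \<frown> path_rev \<alpha>) \<in> pi1_cover X \<U> y"
      and \<epsilon>: "\<epsilon> \<in> loops X x" "B = path_class X \<epsilon>"
        "path_class X (\<alpha> \<frown> \<epsilon> \<frown> path_rev \<alpha>) \<in> pi1_cover X \<U> y"
      by blast
    have "path_class X (\<alpha> \<frown> \<delta> \<frown> path_rev \<alpha>) \<otimes>\<^bsub>pi1 X y\<^esub> path_class X (\<alpha> \<frown> \<epsilon> \<frown> path_rev \<alpha>)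
        = path_class X (\<alpha> \<frown> (\<delta> \<frown> \<epsilon>) \<frown> path_rev \<alpha>)"
      unfolding mult_pi1[OF loop[OF \<delta>(1)] loop[OF \<epsilon>(1)]]
      using \<alpha> \<delta>(1) \<epsilon>(1) by (simp add: loops_def path_class_simps)
    then show ?case
      using \<delta> \<epsilon> S.m_closed[OF \<delta>(3) \<epsilon>(3)] by (intro bexI[of _ "\<delta> \<frown> \<epsilon>"]) (simp_all add: mult_pi1_join)
  qed
qed

lemma pi1_cover_transport:
  assumes "\<alpha> \<in> paths_from X y" "\<alpha> 1 = x" "\<delta> \<in> loops X x" "path_class X \<delta> \<in> pi1_cover X \<U> x"
  shows "path_class X (\<alpha> \<frown> \<delta> \<frown> path_rev \<alpha>) \<in> pi1_cover X \<U> y"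
proof -
  obtain \<epsilon> where \<epsilon>: "\<epsilon> \<in> loops X x" "path_class X \<delta> = path_class X \<epsilon>"
      "path_class X (\<alpha> \<frown> \<epsilon> \<frown> path_rev \<alpha>) \<in> pi1_cover X \<U> y"
    using pi1_cover_transport_ex[OF assms(1,2,4)] by blast
  then have "path_class X (\<alpha> \<frown> \<delta> \<frown> path_rev \<alpha>) = path_class X (\<alpha> \<frown> \<epsilon> \<frown> path_rev \<alpha>)"
    using assms(1-3) by (simp add: loops_def paths_from_def path_class_simps)
  then show ?thesis
    using \<epsilon>(3) by simp
qed

text \<open>Conjugation by a loop is a change of base point.\<close>

lemma normal_pi1_cover:
  assumes "x \<in> topspace X"
  shows "pi1_cover X \<U> x \<lhd> pi1 X x"
proof -
  interpret group "pi1 X x"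
    using assms by (rule group_pi1)
  interpret S: subgroup "pi1_cover X \<U> x" "pi1 X x"
    using assms by (rule subgroup_pi1_cover)
  have "a \<otimes>\<^bsub>pi1 X x\<^esub> b \<otimes>\<^bsub>pi1 X x\<^esub> inv\<^bsub>pi1 X x\<^esub> a \<in> pi1_cover X \<U> x"
    if "a \<in> carrier (pi1 X x)" "b \<in> pi1_cover X \<U> x" for a b
  proof -
    obtain \<alpha> \<delta> where *: "a = path_class X \<alpha>" "\<alpha> \<in> loops X x" "b = path_class X \<delta>" "\<delta> \<in> loops X x"
      using \<open>a \<in> carrier (pi1 X x)\<close> S.mem_carrier[OF \<open>b \<in> pi1_cover X \<U> x\<close>] by auto
    then have "path_class X (\<alpha> \<frown> \<delta> \<frown> path_rev \<alpha>) \<in> pi1_cover X \<U> x"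
      using \<open>b \<in> pi1_cover X \<U> x\<close> by (intro pi1_cover_transport) (simp_all add: loops_def paths_from_def)
    then show ?thesis
      using * by (simp add: inv_pi1 mult_pi1_join)
  qed
  then show ?thesis
    using S.subgroup_axioms normal_inv_iff by blast
qed

lemma pi1_cover_mono:
  assumes "x \<in> topspace X" "\<And>V. V \<in> \<V> \<Longrightarrow> \<exists>U\<in>\<U>. V \<subseteq> U"
  shows "pi1_cover X \<V> x \<subseteq> pi1_cover X \<U> x"
proof -
  have mono: "\<exists>U\<in>\<U>. \<gamma> \<in> loops (subtopology X U) (\<gamma> 0)" if V: "\<exists>V\<in>\<V>. \<gamma> \<in> loops (subtopology X V) (\<gamma> 0)" for \<gamma>
  proof -
    obtain V where "V \<in> \<V>" "\<gamma> \<in> loops (subtopology X V) (\<gamma> 0)"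
      using V by blast
    moreover obtain U where "U \<in> \<U>" "V \<subseteq> U"
      using assms(2) \<open>V \<in> \<V>\<close> by blast
    ultimately show ?thesis
      by (intro bexI[of _ U]) (auto simp: loops_def pathin_subtopology)
  qed
  show ?thesis
    unfolding pi1_cover_def
  proof (rule group.mono_generate[OF group_pi1[OF assms(1)]])
    show "{path_class X (\<alpha> \<frown> \<gamma> \<frown> path_rev \<alpha>) | \<alpha> \<gamma>.
        \<alpha> \<in> paths_from X x \<and> \<alpha> 1 = \<gamma> 0 \<and> (\<exists>U\<in>\<V>. \<gamma> \<in> loops (subtopology X U) (\<gamma> 0))}
      \<subseteq> {path_class X (\<alpha> \<frown> \<gamma> \<frown> path_rev \<alpha>) | \<alpha> \<gamma>.
        \<alpha> \<in> paths_from X x \<and> \<alpha> 1 = \<gamma> 0 \<and> (\<exists>U\<in>\<U>. \<gamma> \<in> loops (subtopology X U) (\<gamma> 0))}"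
      using mono by blast
  qed
qed

text \<open>The subgroup \<open>\<pi>(\<U>, x) H\<close>. Equivalence of paths modulo it is equivalence modulo \<open>H\<close> up to
  differences that are small with respect to \<open>\<U>\<close>.\<close>

definition saturation :: "'a topology \<Rightarrow> 'a \<Rightarrow> (real \<Rightarrow> 'a) set set \<Rightarrow> 'a set set \<Rightarrow> (real \<Rightarrow> 'a) set set"
  where "saturation X x H \<U> = pi1_cover X \<U> x <#>\<^bsub>pi1 X x\<^esub> H"

section \<open>Equivalence of paths modulo a subgroup\<close>

lemma path_diff_loop:
  "\<alpha> \<in> paths_from X x0 \<Longrightarrow> \<beta> \<in> paths_from X x0 \<Longrightarrow> \<alpha> 1 = \<beta> 1 \<Longrightarrow> \<alpha> \<frown> path_rev \<beta> \<in> loops X x0"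
  by (simp add: paths_from_def loops_def pathin_join pathin_rev)

lemma path_diff_mult:
  assumes "\<alpha> \<in> paths_from X x0" "\<beta> \<in> paths_from X x0" "\<gamma> \<in> paths_from X x0" "\<alpha> 1 = \<beta> 1" "\<beta> 1 = \<gamma> 1"
  shows "path_class X (\<alpha> \<frown> path_rev \<beta>) \<otimes>\<^bsub>pi1 X x0\<^esub> path_class X (\<beta> \<frown> path_rev \<gamma>)
    = path_class X (\<alpha> \<frown> path_rev \<gamma>)"
  using assms by (simp add: mult_pi1 path_diff_loop) (simp add: paths_from_def path_class_simps)

lemma path_diff_eq_mult_inv:
  assumes "\<alpha> \<in> loops X x0" "\<beta> \<in> loops X x0"
  shows "path_class X (\<alpha> \<frown> path_rev \<beta>) = path_class X \<alpha> \<otimes>\<^bsub>pi1 X x0\<^esub> inv\<^bsub>pi1 X x0\<^esub> (path_class X \<beta>)"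
  using assms by (simp add: inv_pi1 mult_pi1_join)

lemma path_equiv_mono: "path_equiv X K \<alpha> \<beta> \<Longrightarrow> K \<subseteq> L \<Longrightarrow> path_equiv X L \<alpha> \<beta>"
  by (auto simp: path_equiv_def)

context
  fixes X :: "'a topology" and x0 :: 'a and K :: "(real \<Rightarrow> 'a) set set"
  assumes base: "x0 \<in> topspace X" and K: "subgroup K (pi1 X x0)"
begin

interpretation K: subgroup K "pi1 X x0" by (rule K)

lemma path_equiv_homotopic:
  assumes "path_homotopic X \<alpha> \<beta>" "\<alpha> \<in> paths_from X x0"
  shows "path_equiv X K \<alpha> \<beta>"
proof -
  note * = path_homotopic_imp[OF assms(1)]
  have "path_class X (\<alpha> \<frown> path_rev \<beta>) = \<one>\<^bsub>pi1 X x0\<^esub>"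
    using * assms(2) path_class_eq[OF assms(1)] by (simp add: paths_from_def path_class_simps)
  then show ?thesis
    using * K.one_closed by (simp add: path_equiv_def)
qed

lemma path_equiv_refl: "\<alpha> \<in> paths_from X x0 \<Longrightarrow> path_equiv X K \<alpha> \<alpha>"
  using path_equiv_homotopic[OF path_homotopic_refl] by (simp add: paths_from_def)

lemma path_equiv_sym:
  assumes "path_equiv X K \<alpha> \<beta>" "\<alpha> \<in> paths_from X x0" "\<beta> \<in> paths_from X x0"
  shows "path_equiv X K \<beta> \<alpha>"
proof -
  have "path_class X (\<beta> \<frown> path_rev \<alpha>) = inv\<^bsub>pi1 X x0\<^esub> (path_class X (\<alpha> \<frown> path_rev \<beta>))"
    using assms inv_pi1[OF path_diff_loop[of \<alpha> X x0 \<beta>]] by (simp add: path_equiv_def path_rev_join)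
  then show ?thesis
    using assms K.m_inv_closed by (simp add: path_equiv_def)
qed

lemma path_equiv_trans:
  assumes "path_equiv X K \<alpha> \<beta>" "path_equiv X K \<beta> \<gamma>"
    and "\<alpha> \<in> paths_from X x0" "\<beta> \<in> paths_from X x0" "\<gamma> \<in> paths_from X x0"
  shows "path_equiv X K \<alpha> \<gamma>"
  using assms path_diff_mult[of \<alpha> X x0 \<beta> \<gamma>]
    K.m_closed[of "path_class X (\<alpha> \<frown> path_rev \<beta>)" "path_class X (\<beta> \<frown> path_rev \<gamma>)"]
  by (simp add: path_equiv_def)

lemma path_equiv_join_iff:
  assumes "\<alpha> \<in> paths_from X x0" "\<beta> \<in> paths_from X x0" "\<alpha> 1 = \<beta> 1" "\<gamma> \<in> paths_from X (\<alpha> 1)"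
  shows "path_equiv X K (\<alpha> \<frown> \<gamma>) (\<beta> \<frown> \<gamma>) \<longleftrightarrow> path_equiv X K \<alpha> \<beta>"
proof -
  have "path_class X ((\<alpha> \<frown> \<gamma>) \<frown> path_rev (\<beta> \<frown> \<gamma>)) = path_class X (\<alpha> \<frown> path_rev \<beta>)"
    using assms by (simp add: paths_from_def path_class_simps)
  then show ?thesis
    using assms by (simp add: path_equiv_def)
qed

text \<open>The loop \<open>\<gamma> \<frown> path_rev \<delta>\<close> lies in \<open>V\<close>, so together with \<open>\<alpha>\<close> it gives a generator of the cover
  subgroup, and this generator is the difference of the two paths.\<close>

lemma path_equiv_small:
  assumes "pi1_cover X \<U> x0 \<subseteq> K" "V \<in> \<U>" "\<alpha> \<in> paths_from X x0" "\<gamma> 1 = \<delta> 1"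
    and "\<gamma> \<in> paths_from (subtopology X V) (\<alpha> 1)" "\<delta> \<in> paths_from (subtopology X V) (\<alpha> 1)"
  shows "path_equiv X K (\<alpha> \<frown> \<gamma>) (\<alpha> \<frown> \<delta>)"
proof -
  have paths: "pathin X \<alpha>" "\<alpha> 0 = x0" "pathin X \<gamma>" "\<gamma> 0 = \<alpha> 1" "pathin X \<delta>" "\<delta> 0 = \<alpha> 1"
    using assms(3,5,6) by (simp_all add: paths_from_def pathin_subtopology)
  have "\<gamma> \<frown> path_rev \<delta> \<in> loops (subtopology X V) (\<alpha> 1)"
    using assms(4-6) by (simp add: paths_from_def loops_def pathin_join pathin_rev)
  then have "path_class X (\<alpha> \<frown> (\<gamma> \<frown> path_rev \<delta>) \<frown> path_rev \<alpha>) \<in> pi1_cover X \<U> x0"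
    using assms(2,3) paths by (intro pi1_cover_generator) simp_all
  moreover have "path_class X (\<alpha> \<frown> (\<gamma> \<frown> path_rev \<delta>) \<frown> path_rev \<alpha>)
      = path_class X ((\<alpha> \<frown> \<gamma>) \<frown> path_rev (\<alpha> \<frown> \<delta>))"
    using paths assms(4) by (simp add: path_class_simps)
  ultimately show ?thesis
    using assms(1,4) by (auto simp: path_equiv_def)
qed

end

section \<open>The space of path classes\<close>

context
  fixes X :: "'a topology" and x0 :: 'a and H :: "(real \<Rightarrow> 'a) set set"
  assumes base: "x0 \<in> topspace X" and H: "subgroup H (pi1 X x0)"
begin

interpretation H: subgroup H "pi1 X x0" by (rule H)

interpretation P: group "pi1 X x0" using base by (rule group_pi1)

lemma subgroup_saturation: "subgroup (saturation X x0 H \<U>) (pi1 X x0)"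
  unfolding saturation_def using normal_pi1_cover[OF base] H by (rule P.mult_norm_subgroup)

interpretation C: subgroup "pi1_cover X \<U> x0" "pi1 X x0" for \<U>
  using base by (rule subgroup_pi1_cover)

lemma subset_saturation: "H \<subseteq> saturation X x0 H \<U>" "pi1_cover X \<U> x0 \<subseteq> saturation X x0 H \<U>"
proof -
  have "h \<in> saturation X x0 H \<U>" if "h \<in> H" for h
    using that C.one_closed[of \<U>] P.l_one[OF H.mem_carrier[OF that]]
    unfolding saturation_def set_mult_def by blast
  then show "H \<subseteq> saturation X x0 H \<U>" by blast
  have "h \<in> saturation X x0 H \<U>" if "h \<in> pi1_cover X \<U> x0" for h
    using that H.one_closed P.r_one[OF C.mem_carrier[OF that]]
    unfolding saturation_def set_mult_def by blast
  then show "pi1_cover X \<U> x0 \<subseteq> saturation X x0 H \<U>" by blast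
qed

lemma saturation_mono:
  assumes "\<And>V. V \<in> \<V> \<Longrightarrow> \<exists>U\<in>\<U>. V \<subseteq> U"
  shows "saturation X x0 H \<V> \<subseteq> saturation X x0 H \<U>"
  unfolding saturation_def using pi1_cover_mono[OF base assms] by (intro mono_set_mult) simp_all

lemmas equiv_refl = path_equiv_refl[OF base subgroup_saturation]
  and equiv_sym = path_equiv_sym[OF base subgroup_saturation]
  and equiv_trans = path_equiv_trans[OF base subgroup_saturation]
  and equiv_join_iff = path_equiv_join_iff[OF base subgroup_saturation]

text \<open>A loop \<open>\<delta>\<close> at \<open>\<alpha> 1\<close> whose class belongs to the cover subgroup changes \<open>\<alpha>\<close>, up to homotopy, by the
  loop \<open>\<alpha> \<frown> \<delta> \<frown> path_rev \<alpha>\<close> on the left, whose class belongs to the cover subgroup at the base point.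
  So \<open>\<delta>\<close> can be absorbed into the equivalence relation, and conversely be recovered from it.\<close>

lemma equiv_saturation_iff:
  assumes "\<alpha> \<in> paths_from X x0" "\<beta> \<in> paths_from X x0" "\<gamma> \<in> paths_from X (\<alpha> 1)"
  shows "path_equiv X (saturation X x0 H \<U>) \<beta> (\<alpha> \<frown> \<gamma>) \<longleftrightarrow>
    (\<exists>\<delta>\<in>loops X (\<alpha> 1). path_class X \<delta> \<in> pi1_cover X \<U> (\<alpha> 1) \<and> path_equiv X H \<beta> (\<alpha> \<frown> \<delta> \<frown> \<gamma>))"
    (is "?L \<longleftrightarrow> ?R")
proof
  have paths: "pathin X \<alpha>" "\<alpha> 0 = x0" "pathin X \<gamma>" "\<gamma> 0 = \<alpha> 1" "pathin X \<beta>" "\<beta> 0 = x0"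
    using assms by (simp_all add: paths_from_def)
  have inserted: "\<alpha> \<frown> \<delta> \<frown> \<gamma> \<in> paths_from X x0" if "\<delta> \<in> loops X (\<alpha> 1)" for \<delta>
    using that paths by (simp add: paths_from_def loops_def pathin_join)
  have \<alpha>\<gamma>: "\<alpha> \<frown> \<gamma> \<in> paths_from X x0"
    using paths by (simp add: paths_from_def pathin_join)
  {
    assume ?R
    then obtain \<delta> where \<delta>: "\<delta> \<in> loops X (\<alpha> 1)" "path_class X \<delta> \<in> pi1_cover X \<U> (\<alpha> 1)"
        "path_equiv X H \<beta> (\<alpha> \<frown> \<delta> \<frown> \<gamma>)"
      by blast
    have "path_class X ((\<alpha> \<frown> \<delta> \<frown> \<gamma>) \<frown> path_rev (\<alpha> \<frown> \<gamma>)) = path_class X (\<alpha> \<frown> \<delta> \<frown> path_rev \<alpha>)"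
      using paths \<delta>(1) by (simp add: loops_def path_class_simps)
    also have "\<dots> \<in> pi1_cover X \<U> x0"
      using assms(1) \<delta>(1,2) by (intro pi1_cover_transport) simp_all
    finally have "path_equiv X (saturation X x0 H \<U>) (\<alpha> \<frown> \<delta> \<frown> \<gamma>) (\<alpha> \<frown> \<gamma>)"
      using subset_saturation(2) by (auto simp: path_equiv_def)
    with path_equiv_mono[OF \<delta>(3) subset_saturation(1)] show ?L
      using assms(2) inserted[OF \<delta>(1)] \<alpha>\<gamma> by (rule equiv_trans)
  }
  {
    assume ?L
    then have "path_class X ((\<alpha> \<frown> \<gamma>) \<frown> path_rev \<beta>) \<in> saturation X x0 H \<U>" and ends: "\<beta> 1 = \<gamma> 1"
      using equiv_sym[OF _ assms(2) \<alpha>\<gamma>] by (auto simp: path_equiv_def)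
    then obtain k h where kh: "k \<in> pi1_cover X \<U> x0" "h \<in> H"
        "path_class X ((\<alpha> \<frown> \<gamma>) \<frown> path_rev \<beta>) = k \<otimes>\<^bsub>pi1 X x0\<^esub> h"
      unfolding saturation_def set_mult_def by blast
    obtain \<kappa> \<eta> where \<kappa>: "k = path_class X \<kappa>" "\<kappa> \<in> loops X x0" and \<eta>: "h = path_class X \<eta>" "\<eta> \<in> loops X x0"
      using C.mem_carrier[OF kh(1)] H.mem_carrier[OF kh(2)] by auto
    \<comment> \<open>The part of the difference that comes from the cover, moved from the base point to \<open>\<alpha> 1\<close>.\<close>
    define \<delta> where "\<delta> = path_rev \<alpha> \<frown> path_rev \<kappa> \<frown> \<alpha>"
    have \<delta>: "\<delta> \<in> loops X (\<alpha> 1)"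
      unfolding \<delta>_def using paths \<kappa>(2) by (simp add: loops_def pathin_join pathin_rev)
    have "path_class X (path_rev \<kappa>) \<in> pi1_cover X \<U> x0"
      using C.m_inv_closed[OF kh(1)] \<kappa> by (simp add: inv_pi1)
    then have "path_class X (path_rev \<alpha> \<frown> path_rev \<kappa> \<frown> path_rev (path_rev \<alpha>)) \<in> pi1_cover X \<U> (\<alpha> 1)"
      using paths \<kappa>(2) by (intro pi1_cover_transport) (simp_all add: paths_from_def pathin_rev)
    then have "path_class X \<delta> \<in> pi1_cover X \<U> (\<alpha> 1)"
      by (simp add: \<delta>_def)
    moreover have "path_class X ((\<alpha> \<frown> \<delta> \<frown> \<gamma>) \<frown> path_rev \<beta>) = h"
    proof -
      have "path_class X ((\<alpha> \<frown> \<gamma>) \<frown> path_rev \<beta>) = class_join X (path_class X \<kappa>) (path_class X \<eta>)"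
        using kh(3) \<kappa> \<eta> by (simp add: mult_pi1)
      then have "class_join X (path_class X (path_rev \<kappa>)) (path_class X ((\<alpha> \<frown> \<gamma>) \<frown> path_rev \<beta>)) = path_class X \<eta>"
        using \<kappa>(2) \<eta>(2) by (simp add: loops_def path_class_simps)
      then show ?thesis
        using paths \<kappa>(2) \<eta>(1) ends by (simp add: \<delta>_def loops_def path_class_simps)
    qed
    then have "path_equiv X H (\<alpha> \<frown> \<delta> \<frown> \<gamma>) \<beta>"
      using kh(2) ends by (simp add: path_equiv_def)
    ultimately show ?R
      using \<delta> path_equiv_sym[OF base H _ inserted[OF \<delta>] assms(2)] by blast
  }
qed

lemma tilde_nbhd_eq:
  assumes "\<alpha> \<in> paths_from X x0"
  shows "tilde_nbhd X x0 H \<alpha> \<U> V = {tilde_class X x0 H \<beta> | \<beta>. \<beta> \<in> paths_from X x0 \<and>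
    (\<exists>\<gamma>\<in>paths_from (subtopology X V) (\<alpha> 1). path_equiv X (saturation X x0 H \<U>) \<beta> (\<alpha> \<frown> \<gamma>))}"
proof -
  have "(\<exists>\<gamma>\<in>paths_from (subtopology X V) (\<alpha> 1). \<exists>\<delta>\<in>loops X (\<alpha> 1).
        path_class X \<delta> \<in> pi1_cover X \<U> (\<alpha> 1) \<and> path_equiv X H \<beta> (\<alpha> \<frown> \<delta> \<frown> \<gamma>))
      \<longleftrightarrow> (\<exists>\<gamma>\<in>paths_from (subtopology X V) (\<alpha> 1). path_equiv X (saturation X x0 H \<U>) \<beta> (\<alpha> \<frown> \<gamma>))"
    if "\<beta> \<in> paths_from X x0" for \<beta>
    by (intro bex_cong refl equiv_saturation_iff[OF assms that, symmetric])
      (simp add: paths_from_def pathin_subtopology)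
  then show ?thesis
    unfolding tilde_nbhd_def by blast
qed

lemma tilde_class_eq_iff:
  assumes "\<alpha> \<in> paths_from X x0" "\<beta> \<in> paths_from X x0"
  shows "tilde_class X x0 H \<alpha> = tilde_class X x0 H \<beta> \<longleftrightarrow> path_equiv X H \<alpha> \<beta>"
proof
  assume "tilde_class X x0 H \<alpha> = tilde_class X x0 H \<beta>"
  moreover have "\<beta> \<in> tilde_class X x0 H \<beta>"
    using assms(2) path_equiv_refl[OF base H assms(2)] by (simp add: tilde_class_def)
  ultimately show "path_equiv X H \<alpha> \<beta>"
    by (auto simp: tilde_class_def)
next
  assume eq: "path_equiv X H \<alpha> \<beta>"
  have "path_equiv X H \<alpha> \<gamma> \<longleftrightarrow> path_equiv X H \<beta> \<gamma>" if "\<gamma> \<in> paths_from X x0" for \<gamma>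
    using path_equiv_trans[OF base H eq _ assms that]
      path_equiv_trans[OF base H path_equiv_sym[OF base H eq assms] _ assms(2,1) that] by blast
  then show "tilde_class X x0 H \<alpha> = tilde_class X x0 H \<beta>"
    unfolding tilde_class_def by blast
qed

lemma tilde_class_in_nbhd_iff:
  assumes "\<alpha> \<in> paths_from X x0" "\<beta> \<in> paths_from X x0"
  shows "tilde_class X x0 H \<beta> \<in> tilde_nbhd X x0 H \<alpha> \<U> V \<longleftrightarrow>
    (\<exists>\<gamma>\<in>paths_from (subtopology X V) (\<alpha> 1). path_equiv X (saturation X x0 H \<U>) \<beta> (\<alpha> \<frown> \<gamma>))"
proof
  assume "tilde_class X x0 H \<beta> \<in> tilde_nbhd X x0 H \<alpha> \<U> V"
  then obtain \<beta>' \<gamma> where *: "tilde_class X x0 H \<beta> = tilde_class X x0 H \<beta>'" "\<beta>' \<in> paths_from X x0"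
      "\<gamma> \<in> paths_from (subtopology X V) (\<alpha> 1)" "path_equiv X (saturation X x0 H \<U>) \<beta>' (\<alpha> \<frown> \<gamma>)"
    unfolding tilde_nbhd_eq[OF assms(1)] by blast
  have "path_equiv X (saturation X x0 H \<U>) \<beta> \<beta>'"
    using *(1) unfolding tilde_class_eq_iff[OF assms(2) *(2)]
    by (rule path_equiv_mono) (rule subset_saturation)
  moreover have "\<alpha> \<frown> \<gamma> \<in> paths_from X x0"
    using assms(1) *(3) by (simp add: paths_from_def pathin_subtopology pathin_join)
  ultimately have "path_equiv X (saturation X x0 H \<U>) \<beta> (\<alpha> \<frown> \<gamma>)"
    using equiv_trans[of \<U> \<beta> \<beta>' "\<alpha> \<frown> \<gamma>"] *(4) assms(2) *(2) by simp
  then show "\<exists>\<gamma>\<in>paths_from (subtopology X V) (\<alpha> 1). path_equiv X (saturation X x0 H \<U>) \<beta> (\<alpha> \<frown> \<gamma>)"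
    using *(3) by blast
qed (use assms in \<open>auto simp: tilde_nbhd_eq\<close>)

text \<open>The path in \<open>V\<close> can be taken to be constant.\<close>

lemma tilde_class_in_nbhd_if_equiv:
  assumes "\<alpha> \<in> paths_from X x0" "\<beta> \<in> paths_from X x0" "\<alpha> 1 \<in> V"
    and "path_equiv X (saturation X x0 H \<U>) \<beta> \<alpha>"
  shows "tilde_class X x0 H \<beta> \<in> tilde_nbhd X x0 H \<alpha> \<U> V"
proof -
  have \<alpha>: "pathin X \<alpha>" "\<alpha> 0 = x0" "\<alpha> 1 \<in> topspace X"
    using assms(1) path_end_in_topspace(2) by (auto simp: paths_from_def)
  then have c: "(\<lambda>_. \<alpha> 1) \<in> paths_from (subtopology X V) (\<alpha> 1)"
    using assms(3) by (simp add: paths_from_def)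
  have "path_homotopic X \<alpha> (\<alpha> \<frown> (\<lambda>_. \<alpha> 1))"
    using path_homotopic_units(1)[OF \<alpha>(1)] by (rule path_homotopic_sym)
  then have "path_equiv X (saturation X x0 H \<U>) \<alpha> (\<alpha> \<frown> (\<lambda>_. \<alpha> 1))"
    using assms(1) by (rule path_equiv_homotopic[OF base subgroup_saturation])
  moreover have "\<alpha> \<frown> (\<lambda>_. \<alpha> 1) \<in> paths_from X x0"
    using \<alpha> by (simp add: paths_from_def pathin_join)
  ultimately have "path_equiv X (saturation X x0 H \<U>) \<beta> (\<alpha> \<frown> (\<lambda>_. \<alpha> 1))"
    using equiv_trans[of \<U> \<beta> \<alpha> "\<alpha> \<frown> (\<lambda>_. \<alpha> 1)"] assms by simp
  then show ?thesis
    using c assms(1,2) tilde_class_in_nbhd_iff by blast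
qed

text \<open>Modulo the saturation a motion in \<open>V\<close> from \<open>\<alpha>\<close> to \<open>\<beta>\<close> can be continued by a motion in \<open>V\<close> from \<open>\<beta>\<close>.\<close>

lemma tilde_nbhd_subset:
  assumes "\<alpha> \<in> paths_from X x0" "\<beta> \<in> paths_from X x0"
    and "tilde_class X x0 H \<beta> \<in> tilde_nbhd X x0 H \<alpha> \<U> V"
  shows "tilde_nbhd X x0 H \<beta> \<U> V \<subseteq> tilde_nbhd X x0 H \<alpha> \<U> V"
proof
  obtain \<gamma> where \<gamma>: "\<gamma> \<in> paths_from (subtopology X V) (\<alpha> 1)" "path_equiv X (saturation X x0 H \<U>) \<beta> (\<alpha> \<frown> \<gamma>)"
    using assms tilde_class_in_nbhd_iff by blast
  fix c assume "c \<in> tilde_nbhd X x0 H \<beta> \<U> V"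
  then obtain \<epsilon> \<delta> where c: "c = tilde_class X x0 H \<epsilon>" "\<epsilon> \<in> paths_from X x0"
      "\<delta> \<in> paths_from (subtopology X V) (\<beta> 1)" "path_equiv X (saturation X x0 H \<U>) \<epsilon> (\<beta> \<frown> \<delta>)"
    unfolding tilde_nbhd_eq[OF assms(2)] by blast
  have ends: "\<beta> 1 = \<gamma> 1"
    using \<gamma>(2) by (simp add: path_equiv_def)
  have paths: "pathin X \<alpha>" "\<alpha> 0 = x0" "pathin X \<beta>" "\<beta> 0 = x0" "pathin X \<gamma>" "\<gamma> 0 = \<alpha> 1" "pathin X \<delta>" "\<delta> 0 = \<gamma> 1"
    using assms(1,2) \<gamma>(1) c(3) ends by (simp_all add: paths_from_def pathin_subtopology)
  have joins: "\<beta> \<frown> \<delta> \<in> paths_from X x0" "(\<alpha> \<frown> \<gamma>) \<frown> \<delta> \<in> paths_from X x0" "\<alpha> \<frown> (\<gamma> \<frown> \<delta>) \<in> paths_from X x0"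
      "\<alpha> \<frown> \<gamma> \<in> paths_from X x0" "\<delta> \<in> paths_from X (\<beta> 1)"
    using paths ends by (simp_all add: paths_from_def pathin_join)
  have "path_equiv X (saturation X x0 H \<U>) (\<beta> \<frown> \<delta>) ((\<alpha> \<frown> \<gamma>) \<frown> \<delta>)"
    using \<gamma>(2) assms(2) joins ends by (subst equiv_join_iff) simp_all
  with c(4) have "path_equiv X (saturation X x0 H \<U>) \<epsilon> ((\<alpha> \<frown> \<gamma>) \<frown> \<delta>)"
    using c(2) joins(1,2) by (rule equiv_trans)
  moreover have "path_equiv X (saturation X x0 H \<U>) ((\<alpha> \<frown> \<gamma>) \<frown> \<delta>) (\<alpha> \<frown> (\<gamma> \<frown> \<delta>))"
    using path_homotopic_assoc[of X \<alpha> \<gamma> \<delta>] paths joins(2)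
    by (intro path_equiv_homotopic[OF base subgroup_saturation]) simp_all
  ultimately have "path_equiv X (saturation X x0 H \<U>) \<epsilon> (\<alpha> \<frown> (\<gamma> \<frown> \<delta>))"
    using c(2) joins(2,3) by (rule equiv_trans)
  moreover have "\<gamma> \<frown> \<delta> \<in> paths_from (subtopology X V) (\<alpha> 1)"
    using \<gamma>(1) c(3) ends by (simp add: paths_from_def pathin_join)
  ultimately show "c \<in> tilde_nbhd X x0 H \<alpha> \<U> V"
    using c(1,2) assms(1) tilde_class_in_nbhd_iff by blast
qed

lemma openin_tilde_nbhd:
  assumes "open_cover X \<U>" "\<alpha> \<in> paths_from X x0" "V \<in> \<U>" "\<alpha> 1 \<in> V"
  shows "openin (tilde_space X x0 H) (tilde_nbhd X x0 H \<alpha> \<U> V)"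
  unfolding tilde_space_def 
  by (rule topology_generated_by_Basis, rule CollectI, intro exI conjI refl) (use assms in simp_all)

text \<open>Two basic neighbourhoods of a class contain the one belonging to the common refinement of the
  covers, because a finer cover has a smaller saturation.\<close>

lemma openin_tilde_spaceD:
  assumes "openin (tilde_space X x0 H) W" "\<alpha> \<in> paths_from X x0" "tilde_class X x0 H \<alpha> \<in> W"
  obtains \<U> V where "open_cover X \<U>" "V \<in> \<U>" "\<alpha> 1 \<in> V" "tilde_nbhd X x0 H \<alpha> \<U> V \<subseteq> W"
proof -
  have "generate_topology_on {tilde_nbhd X x0 H \<alpha> \<U> V | \<alpha> \<U> V.
       open_cover X \<U> \<and> \<alpha> \<in> paths_from X x0 \<and> V \<in> \<U> \<and> \<alpha> 1 \<in> V} W"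
    using assms(1) unfolding tilde_space_def openin_topology_generated_by_iff .
  then have "\<exists>\<U> V. open_cover X \<U> \<and> V \<in> \<U> \<and> \<alpha> 1 \<in> V \<and> tilde_nbhd X x0 H \<alpha> \<U> V \<subseteq> W"
    using assms(3)
  proof induction
    case (Int a b)
    then obtain \<U> V \<U>' V' where *: "open_cover X \<U>" "V \<in> \<U>" "\<alpha> 1 \<in> V" "tilde_nbhd X x0 H \<alpha> \<U> V \<subseteq> a"
      "open_cover X \<U>'" "V' \<in> \<U>'" "\<alpha> 1 \<in> V'" "tilde_nbhd X x0 H \<alpha> \<U>' V' \<subseteq> b"
      by blast
    define \<W> where "\<W> = {U \<inter> U' | U U'. U \<in> \<U> \<and> U' \<in> \<U>'}"
    have "open_cover X \<W>"
      using *(1,5) unfolding open_cover_def \<W>_def by (auto, blast)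
    moreover have "V \<inter> V' \<in> \<W>" "\<alpha> 1 \<in> V \<inter> V'"
      using * by (auto simp: \<W>_def)
    moreover have "tilde_nbhd X x0 H \<alpha> \<W> (V \<inter> V') \<subseteq> tilde_nbhd X x0 H \<alpha> \<U> V \<inter> tilde_nbhd X x0 H \<alpha> \<U>' V'"
    proof -
      have "paths_from (subtopology X (V \<inter> V')) (\<alpha> 1) \<subseteq> paths_from (subtopology X V) (\<alpha> 1)"
        "paths_from (subtopology X (V \<inter> V')) (\<alpha> 1) \<subseteq> paths_from (subtopology X V') (\<alpha> 1)"
        by (auto simp: paths_from_def pathin_subtopology)
      moreover have "saturation X x0 H \<W> \<subseteq> saturation X x0 H \<U>" "saturation X x0 H \<W> \<subseteq> saturation X x0 H \<U>'"
        by (auto intro!: saturation_mono simp: \<W>_def)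
      ultimately show ?thesis
        unfolding tilde_nbhd_eq[OF assms(2)] using path_equiv_mono by blast
    qed
    ultimately show ?case
      using *(4,8) by blast
  next
    case (Basis s)
    then obtain \<beta> \<U> V where *: "s = tilde_nbhd X x0 H \<beta> \<U> V" "open_cover X \<U>" "\<beta> \<in> paths_from X x0" "V \<in> \<U>" "\<beta> 1 \<in> V"
      by blast
    obtain \<gamma> where "\<gamma> \<in> paths_from (subtopology X V) (\<beta> 1)" "path_equiv X (saturation X x0 H \<U>) \<alpha> (\<beta> \<frown> \<gamma>)"
      using Basis(2) tilde_class_in_nbhd_iff[OF *(3) assms(2)] *(1) by blast
    then have "\<alpha> 1 \<in> V"
      using path_end_in_topspace(2)[of "subtopology X V" \<gamma>] by (auto simp: paths_from_def path_equiv_def)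
    then show ?case
      using * tilde_nbhd_subset[OF *(3) assms(2)] Basis(2) by blast
  next
    case (UN \<K>)
    then obtain S where "S \<in> \<K>" "tilde_class X x0 H \<alpha> \<in> S"
      by blast
    from UN.IH[OF this] show ?case
      using \<open>S \<in> \<K>\<close> by (meson Union_upper order_trans)
  qed simp
  then show thesis
    by (elim exE conjE) (rule that)
qed

lemma topspace_tilde_space: "topspace (tilde_space X x0 H) = tilde_class X x0 H ` paths_from X x0"
proof -
  have "tilde_class X x0 H \<alpha> \<in> topspace (tilde_space X x0 H)" if "\<alpha> \<in> paths_from X x0" for \<alpha>
  proof -
    have "\<alpha> 1 \<in> topspace X"
      using that path_end_in_topspace(2) by (auto simp: paths_from_def)
    moreover have "open_cover X {topspace X}"
      by (simp add: open_cover_def)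
    ultimately have "openin (tilde_space X x0 H) (tilde_nbhd X x0 H \<alpha> {topspace X} (topspace X))"
      using that by (intro openin_tilde_nbhd) simp_all
    moreover have "tilde_class X x0 H \<alpha> \<in> tilde_nbhd X x0 H \<alpha> {topspace X} (topspace X)"
      using that \<open>\<alpha> 1 \<in> topspace X\<close> by (intro tilde_class_in_nbhd_if_equiv equiv_refl) simp_all
    ultimately show ?thesis
      using openin_subset by blast
  qed
  moreover have "topspace (tilde_space X x0 H) \<subseteq> tilde_class X x0 H ` paths_from X x0"
    unfolding tilde_space_def topology_generated_by_topspace tilde_nbhd_def by blast
  ultimately show ?thesis
    by blast
qed

lemma endpoint_proj_tilde_class:
  assumes "\<alpha> \<in> paths_from X x0"
  shows "endpoint_proj (tilde_class X x0 H \<alpha>) = \<alpha> 1"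
proof -
  have "\<alpha> \<in> tilde_class X x0 H \<alpha>"
    using assms path_equiv_refl[OF base H assms] by (simp add: tilde_class_def)
  then have "(SOME \<beta>. \<beta> \<in> tilde_class X x0 H \<alpha>) \<in> tilde_class X x0 H \<alpha>"
    using someI[of "\<lambda>\<beta>. \<beta> \<in> tilde_class X x0 H \<alpha>"] by blast
  then show ?thesis
    by (simp add: endpoint_proj_def tilde_class_def path_equiv_def)
qed

text \<open>The cover that consists of \<open>U\<close> and the whole space shows that the preimage of \<open>U\<close> is open.\<close>

lemma continuous_endpoint_proj: "continuous_map (tilde_space X x0 H) X endpoint_proj"
  unfolding continuous_map
proof (intro conjI allI impI)
  show "endpoint_proj ` topspace (tilde_space X x0 H) \<subseteq> topspace X"
    unfolding topspace_tilde_space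
  proof clarify
    fix \<alpha> assume \<alpha>: "\<alpha> \<in> paths_from X x0"
    then show "endpoint_proj (tilde_class X x0 H \<alpha>) \<in> topspace X"
      unfolding endpoint_proj_tilde_class[OF \<alpha>]
      by (intro path_end_in_topspace) (simp add: paths_from_def)
  qed
next
  fix U assume U: "openin X U"
  let ?\<U> = "{U, topspace X}"
  have cover: "open_cover X ?\<U>"
    using U openin_subset[OF U] by (auto simp: open_cover_def)
  have "\<exists>W. openin (tilde_space X x0 H) W \<and> c \<in> W \<and>
      W \<subseteq> {c \<in> topspace (tilde_space X x0 H). endpoint_proj c \<in> U}"
    if c: "c \<in> topspace (tilde_space X x0 H)" "endpoint_proj c \<in> U" for c
  proof -
    obtain \<alpha> where \<alpha>: "c = tilde_class X x0 H \<alpha>" "\<alpha> \<in> paths_from X x0"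
      using c(1) unfolding topspace_tilde_space by blast
    then have "\<alpha> 1 \<in> U"
      using c(2) by (simp add: endpoint_proj_tilde_class)
    note \<alpha> = \<alpha> this
    have "tilde_nbhd X x0 H \<alpha> ?\<U> U \<subseteq> {c \<in> topspace (tilde_space X x0 H). endpoint_proj c \<in> U}"
    proof
      fix d assume "d \<in> tilde_nbhd X x0 H \<alpha> ?\<U> U"
      then obtain \<beta> \<gamma> where *: "d = tilde_class X x0 H \<beta>" "\<beta> \<in> paths_from X x0"
          "\<gamma> \<in> paths_from (subtopology X U) (\<alpha> 1)" "path_equiv X (saturation X x0 H ?\<U>) \<beta> (\<alpha> \<frown> \<gamma>)"
        unfolding tilde_nbhd_eq[OF \<alpha>(2)] by blast
      then have "\<beta> 1 \<in> U"
        using path_end_in_topspace(2)[of "subtopology X U" \<gamma>] by (auto simp: paths_from_def path_equiv_def)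
      then show "d \<in> {c \<in> topspace (tilde_space X x0 H). endpoint_proj c \<in> U}"
        using * by (simp add: topspace_tilde_space endpoint_proj_tilde_class)
    qed
    moreover have "openin (tilde_space X x0 H) (tilde_nbhd X x0 H \<alpha> ?\<U> U)"
      using cover \<alpha> by (intro openin_tilde_nbhd) simp_all
    moreover have "c \<in> tilde_nbhd X x0 H \<alpha> ?\<U> U"
      unfolding \<alpha>(1) using \<alpha>(2,3) by (intro tilde_class_in_nbhd_if_equiv equiv_refl)
    ultimately show ?thesis
      by blast
  qed
  then show "openin (tilde_space X x0 H) {c \<in> topspace (tilde_space X x0 H). endpoint_proj c \<in> U}"
    by (subst openin_subopen) blast
qed

end

section \<open>Lifting maps from convex sets\<close>

context
  fixes X :: "'a topology" and x0 :: 'a and H :: "(real \<Rightarrow> 'a) set set"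
  assumes base: "x0 \<in> topspace X" and H: "subgroup H (pi1 X x0)"
begin

text \<open>The lift sends \<open>z\<close> to the class of the image of the segment from \<open>z0\<close> to \<open>z\<close>. It is continuous
  because, by convexity, moving from \<open>z\<close> to a nearby \<open>z'\<close> appends the image of the short segment from
  \<open>z\<close> to \<open>z'\<close>.\<close>

lemma
  fixes C :: "'b::real_normed_vector set"
  assumes "convex C" "continuous_map (top_of_set C) X h" "z0 \<in> C" "h z0 = x0"
  shows segment_image_paths: "\<And>z. z \<in> C \<Longrightarrow> h \<circ> linepath z0 z \<in> paths_from X x0"
    and continuous_segment_lift:
      "continuous_map (top_of_set C) (tilde_space X x0 H) (\<lambda>z. tilde_class X x0 H (h \<circ> linepath z0 z))"
proof -
  have segment: "continuous_map unit_interval (top_of_set C) (linepath a b)" if "a \<in> C" "b \<in> C" for a b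
  proof -
    have "linepath a b ` {0..1} \<subseteq> C"
      using that assms(1) by (simp add: linepath_image_01 closed_segment_subset)
    then show ?thesis
      using path_linepath[of a b] by (auto simp: path_def)
  qed
  have image: "pathin X (h \<circ> linepath a b)" if "a \<in> C" "b \<in> C" for a b
    unfolding pathin_def using segment[OF that] assms(2) by (rule continuous_map_compose)
  then show paths: "h \<circ> linepath z0 z \<in> paths_from X x0" if "z \<in> C" for z
    using that assms(3,4) by (simp add: paths_from_def linepath_def)
  let ?lift = "\<lambda>z. tilde_class X x0 H (h \<circ> linepath z0 z)"
  show "continuous_map (top_of_set C) (tilde_space X x0 H) ?lift"
    unfolding continuous_map
  proof (intro conjI allI impI)
    show "?lift ` topspace (top_of_set C) \<subseteq> topspace (tilde_space X x0 H)"
      using paths topspace_tilde_space[OF base H] by auto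
  next
    fix W assume W: "openin (tilde_space X x0 H) W"
    have "\<exists>N. openin (top_of_set C) N \<and> z \<in> N \<and> N \<subseteq> {z \<in> topspace (top_of_set C). ?lift z \<in> W}"
      if "z \<in> {z \<in> topspace (top_of_set C). ?lift z \<in> W}" for z
    proof -
      have z: "z \<in> C" "?lift z \<in> W"
        using that by simp_all
      obtain \<U> V where UV: "open_cover X \<U>" "V \<in> \<U>" "(h \<circ> linepath z0 z) 1 \<in> V"
          "tilde_nbhd X x0 H (h \<circ> linepath z0 z) \<U> V \<subseteq> W"
        using openin_tilde_spaceD[OF base H W paths[OF z(1)] z(2)] by blast
      have "openin X V"
        using UV(1,2) by (simp add: open_cover_def)
      then have "openin (top_of_set C) {z' \<in> C. h z' \<in> V}"
        using openin_continuous_map_preimage[OF assms(2)] by fastforce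
      moreover have "z \<in> {z' \<in> C. h z' \<in> V}"
        using z(1) UV(3) by (simp add: linepath_def)
      ultimately obtain e where e: "e > 0" "ball z e \<inter> C \<subseteq> {z' \<in> C. h z' \<in> V}"
        unfolding openin_contains_ball by blast
      have "?lift z' \<in> W" if z': "z' \<in> ball z e \<inter> C" for z'
      proof -
        have "z' \<in> C" using z' by blast
        have "closed_segment z z' \<subseteq> ball z e \<inter> C"
          using z' z(1) e(1) assms(1) by (intro closed_segment_subset convex_Int) auto
        then have "h (linepath z z' t) \<in> V" if "t \<in> {0..1}" for t
          using e(2) that linepath_image_01[of z z'] by blast
        then have "h \<circ> linepath z z' \<in> paths_from (subtopology X V) ((h \<circ> linepath z0 z) 1)"
          using image[OF z(1) \<open>z' \<in> C\<close>] by (simp add: paths_from_def pathin_subtopology linepath_def)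
        moreover have "path_homotopic X (h \<circ> linepath z0 z') ((h \<circ> linepath z0 z) \<frown> (h \<circ> linepath z z'))"
        proof -
          have sub: "closed_segment z0 z \<subseteq> C" "closed_segment z z' \<subseteq> C" "closed_segment z0 z' \<subseteq> C"
            using assms(1,3) z(1) \<open>z' \<in> C\<close> by (simp_all add: closed_segment_subset)
          have "path_homotopic X (h \<circ> linepath z0 z') (h \<circ> (linepath z0 z \<frown> linepath z z'))"
            using assms(1,2)
          proof (rule path_homotopic_convex_image)
            show "path (linepath z0 z \<frown> linepath z z')" "path_image (linepath z0 z \<frown> linepath z z') \<subseteq> C"
              using sub by (auto simp: path_join_eq_joinpaths path_image_join)
            show "path (linepath z0 z')" "path_image (linepath z0 z') \<subseteq> C"
              using sub by simp_all
          qed (simp_all add: linepath_def)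
          then show ?thesis
            by (simp only: comp_path_join)
        qed
        then have "path_equiv X (saturation X x0 H \<U>) (h \<circ> linepath z0 z')
            ((h \<circ> linepath z0 z) \<frown> (h \<circ> linepath z z'))"
          using paths[OF \<open>z' \<in> C\<close>] by (rule path_equiv_homotopic[OF base subgroup_saturation[OF base H]])
        ultimately have "?lift z' \<in> tilde_nbhd X x0 H (h \<circ> linepath z0 z) \<U> V"
          using tilde_class_in_nbhd_iff[OF base H paths[OF z(1)] paths[OF \<open>z' \<in> C\<close>]] by blast
        then show ?thesis
          using UV(4) by blast
      qed
      moreover have "openin (top_of_set C) (ball z e \<inter> C)"
        by (simp add: Int_commute openin_open_Int)
      moreover have "z \<in> ball z e \<inter> C"
        using e(1) z(1) by simp
      ultimately show ?thesis
        by (intro exI[of _ "ball z e \<inter> C"]) auto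
    qed
    then show "openin (top_of_set C) {z \<in> topspace (top_of_set C). ?lift z \<in> W}"
      by (subst openin_subopen) blast
  qed
qed

lemma path_lift:
  assumes "\<alpha> \<in> paths_from X x0"
  obtains \<beta> where "\<beta> \<in> paths_from (tilde_space X x0 H) (tilde_base X x0 H)"
    "\<And>t. t \<in> {0..1} \<Longrightarrow> endpoint_proj (\<beta> t) = \<alpha> t" "\<beta> 1 = tilde_class X x0 H \<alpha>"
proof
  have \<alpha>: "continuous_map unit_interval X \<alpha>" "\<alpha> 0 = x0"
    using assms by (simp_all add: paths_from_def pathin_def)
  let ?\<beta> = "\<lambda>t. tilde_class X x0 H (\<alpha> \<circ> linepath 0 t)"
  have "\<alpha> \<circ> linepath 0 0 = (\<lambda>_. x0)"
    using \<alpha>(2) by (simp add: linepath_def o_def)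
  then show "?\<beta> \<in> paths_from (tilde_space X x0 H) (tilde_base X x0 H)"
    using continuous_segment_lift[OF _ \<alpha>(1) _ \<alpha>(2)]
    by (simp add: paths_from_def pathin_def tilde_base_def)
  show "endpoint_proj (?\<beta> t) = \<alpha> t" if "t \<in> {0..1}" for t
    using endpoint_proj_tilde_class[OF base H segment_image_paths[OF _ \<alpha>(1) _ \<alpha>(2) that]]
    by (simp add: linepath_def)
  show "?\<beta> 1 = tilde_class X x0 H \<alpha>"
    by simp
qed

section \<open>Uniqueness of lifts\<close>

text \<open>Two lifts of one path stay equivalent modulo \<open>\<pi>(\<U>, x0) H\<close> for a fixed cover \<open>\<U>\<close>: near any
  parameter both lifts move by paths inside one member of \<open>\<U>\<close> with the same end points, and these are
  interchangeable modulo \<open>\<pi>(\<U>, x0)\<close>. So equivalence is a locally constant property of the parameter,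
  and it holds at \<open>0\<close>.\<close>

lemma lifts_equiv_saturation:
  assumes cover: "open_cover X \<U>"
    and \<alpha>: "\<alpha> \<in> paths_from (tilde_space X x0 H) (tilde_base X x0 H)"
    and \<beta>: "\<beta> \<in> paths_from (tilde_space X x0 H) (tilde_base X x0 H)"
    and a: "\<And>t. t \<in> {0..1} \<Longrightarrow> a t \<in> paths_from X x0" "\<And>t. t \<in> {0..1} \<Longrightarrow> \<alpha> t = tilde_class X x0 H (a t)"
    and b: "\<And>t. t \<in> {0..1} \<Longrightarrow> b t \<in> paths_from X x0" "\<And>t. t \<in> {0..1} \<Longrightarrow> \<beta> t = tilde_class X x0 H (b t)"
    and ends: "\<And>t. t \<in> {0..1} \<Longrightarrow> a t 1 = b t 1"
    and t: "t \<in> {0..1}"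
  shows "path_equiv X (saturation X x0 H \<U>) (a t) (b t)"
proof -
  let ?E = "path_equiv X (saturation X x0 H \<U>)"
  note S = subgroup_saturation[OF base H, of \<U>]
  note sym = path_equiv_sym[OF base S] and trans = path_equiv_trans[OF base S]
    and join = path_equiv_join_iff[OF base S]
  note small = path_equiv_small[OF base S subset_saturation(2)[OF base H]]
  have zero: "(0::real) \<in> {0..1}" by simp
  have "\<alpha> 0 = \<beta> 0"
    using \<alpha> \<beta> by (simp add: paths_from_def)
  then have "path_equiv X H (a 0) (b 0)"
    using tilde_class_eq_iff[OF base H a(1)[OF zero] b(1)[OF zero]] a(2)[OF zero] b(2)[OF zero] by simp
  then have start: "?E (a 0) (b 0)"
    using subset_saturation(1)[OF base H] by (rule path_equiv_mono)
  have "?E (a 0) (b 0) \<longleftrightarrow> ?E (a t) (b t)"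
  proof (rule connected_equivalence_relation[where S="{0..1::real}" and R="\<lambda>s t. ?E (a s) (b s) \<longleftrightarrow> ?E (a t) (b t)"])
    fix r :: real assume r: "r \<in> {0..1}"
    note ar = a(1)[OF r] and br = b(1)[OF r]
    have "a r 1 \<in> topspace X"
      using ar path_end_in_topspace(2)[of X "a r"] by (simp add: paths_from_def)
    then obtain V where V: "V \<in> \<U>" "a r 1 \<in> V"
      using cover unfolding open_cover_def by blast
    let ?A = "tilde_nbhd X x0 H (a r) \<U> V" and ?B = "tilde_nbhd X x0 H (b r) \<U> V"
    define N where "N = {s \<in> {0..1}. \<alpha> s \<in> ?A} \<inter> {s \<in> {0..1}. \<beta> s \<in> ?B}"
    have open_AB: "openin (tilde_space X x0 H) ?A" "openin (tilde_space X x0 H) ?B"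
      using openin_tilde_nbhd[OF base H cover _ V(1)] ar br V(2) ends[OF r] by simp_all
    have "openin unit_interval {s \<in> {0..1}. \<alpha> s \<in> ?A}" "openin unit_interval {s \<in> {0..1}. \<beta> s \<in> ?B}"
      using openin_continuous_map_preimage[OF _ open_AB(1), of unit_interval \<alpha>]
        openin_continuous_map_preimage[OF _ open_AB(2), of unit_interval \<beta>] \<alpha> \<beta>
      by (simp_all add: paths_from_def pathin_def)
    then have "openin unit_interval N"
      unfolding N_def by (rule openin_Int)
    moreover have "r \<in> N"
      using r a(2)[OF r] b(2)[OF r] ar br V(2) ends[OF r] tilde_class_in_nbhd_if_equiv[OF base H]
        path_equiv_refl[OF base S] by (simp add: N_def)
    moreover have "?E (a r) (b r) \<longleftrightarrow> ?E (a s) (b s)" if "s \<in> N" for s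
    proof -
      have s: "s \<in> {0..1}" "tilde_class X x0 H (a s) \<in> ?A" "tilde_class X x0 H (b s) \<in> ?B"
        using \<open>s \<in> N\<close> a(2) b(2) by (auto simp: N_def)
      note as = a(1)[OF s(1)] and bs = b(1)[OF s(1)]
      obtain \<gamma> where \<gamma>: "\<gamma> \<in> paths_from (subtopology X V) (a r 1)" "?E (a s) (a r \<frown> \<gamma>)"
        using s(2) tilde_class_in_nbhd_iff[OF base H ar as] by blast
      obtain \<delta> where \<delta>: "\<delta> \<in> paths_from (subtopology X V) (b r 1)" "?E (b s) (b r \<frown> \<delta>)"
        using s(3) tilde_class_in_nbhd_iff[OF base H br bs] by blast
      have \<gamma>': "\<gamma> \<in> paths_from X (a r 1)" "\<delta> \<in> paths_from X (a r 1)"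
        using \<gamma>(1) \<delta>(1) ends[OF r] by (simp_all add: paths_from_def pathin_subtopology)
      have joins: "a r \<frown> \<gamma> \<in> paths_from X x0" "b r \<frown> \<gamma> \<in> paths_from X x0" "b r \<frown> \<delta> \<in> paths_from X x0"
        using ar br \<gamma>' ends[OF r] by (simp_all add: paths_from_def pathin_join)
      have "\<gamma> 1 = \<delta> 1"
        using \<gamma>(2) \<delta>(2) ends[OF s(1)] by (simp add: path_equiv_def)
      then have \<gamma>\<delta>: "?E (b r \<frown> \<gamma>) (b r \<frown> \<delta>)"
        using \<gamma>(1) \<delta>(1) ends[OF r] br V(1) by (intro small) simp_all
      have "?E (a r) (b r) \<longleftrightarrow> ?E (a r \<frown> \<gamma>) (b r \<frown> \<gamma>)"
        using join[OF ar br ends[OF r] \<gamma>'(1)] by simp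
      also have "\<dots> \<longleftrightarrow> ?E (a r \<frown> \<gamma>) (b r \<frown> \<delta>)"
        using trans[OF _ \<gamma>\<delta> joins] trans[OF _ sym[OF \<gamma>\<delta> joins(2,3)] joins(1,3,2)] by blast
      also have "\<dots> \<longleftrightarrow> ?E (a s) (b r \<frown> \<delta>)"
        using trans[OF \<gamma>(2) _ as joins(1,3)] trans[OF sym[OF \<gamma>(2) as joins(1)] _ joins(1) as joins(3)] by blast
      also have "\<dots> \<longleftrightarrow> ?E (a s) (b s)"
        using trans[OF _ \<delta>(2) as bs joins(3)] trans[OF _ sym[OF \<delta>(2) bs joins(3)] as joins(3) bs] by blast
      finally show ?thesis .
    qed
    ultimately show "\<exists>T. openin (top_of_set {0..1}) T \<and> r \<in> T \<and> (\<forall>s\<in>T. ?E (a r) (b r) \<longleftrightarrow> ?E (a s) (b s))"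
      by blast
  qed (use t in auto)
  with start show ?thesis
    by simp
qed

end

section \<open>Closed subgroups\<close>

lemma carrier_classE:
  assumes "g \<in> carrier (pi1 X x0)"
  obtains \<alpha> where "g = path_class X \<alpha>" "\<alpha> \<in> loops X x0" "\<alpha> \<in> paths_from X x0"
  using assms by (auto simp: loops_def paths_from_def)

text \<open>Modulo the trivial subgroup, equivalence of paths is homotopy. The topology of the fundamental
  group therefore lives on the classes of loops themselves.\<close>

lemma tilde_class_trivial:
  assumes "\<alpha> \<in> paths_from X x0"
  shows "tilde_class X x0 {\<one>\<^bsub>pi1 X x0\<^esub>} \<alpha> = path_class X \<alpha>"
proof -
  have \<alpha>: "pathin X \<alpha>" "\<alpha> 0 = x0"
    using assms by (simp_all add: paths_from_def)
  have "path_homotopic X \<alpha> \<beta>" if \<beta>: "\<beta> \<in> paths_from X x0" "\<alpha> 1 = \<beta> 1"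
      "path_class X (\<alpha> \<frown> path_rev \<beta>) = path_class X (\<lambda>_. x0)" for \<beta>
  proof -
    have paths: "pathin X \<beta>" "\<beta> 0 = x0"
      using \<beta>(1) by (simp_all add: paths_from_def)
    have "path_class X \<alpha> = class_join X (path_class X (\<alpha> \<frown> path_rev \<beta>)) (path_class X \<beta>)"
      using paths \<alpha> \<beta>(2) by (simp add: path_class_simps)
    also have "\<dots> = path_class X \<beta>"
      unfolding \<beta>(3) using paths by (simp add: path_class_simps)
    finally show ?thesis
      using paths(1) by (rule path_class_eqD)
  qed
  moreover have "\<beta> \<in> paths_from X x0 \<and> \<alpha> 1 = \<beta> 1 \<and> path_class X (\<alpha> \<frown> path_rev \<beta>) = path_class X (\<lambda>_. x0)"
    if "path_homotopic X \<alpha> \<beta>" for \<beta>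
  proof -
    have \<beta>: "pathin X \<beta>" "\<alpha> 0 = \<beta> 0" "\<alpha> 1 = \<beta> 1"
      using path_homotopic_imp[OF that] by simp_all
    moreover have "path_class X (\<alpha> \<frown> path_rev \<beta>) = path_class X (\<lambda>_. x0)"
      using \<beta> \<alpha> path_class_eq[OF that] by (simp add: path_class_simps)
    ultimately show ?thesis
      using \<alpha>(2) by (simp add: paths_from_def)
  qed
  ultimately show ?thesis
    unfolding tilde_class_def path_class_def path_equiv_def pi1_simps singleton_iff
    by (metis (mono_tags, lifting) path_class_def)
qed

context
  fixes X :: "'a topology" and x0 :: 'a
  assumes base: "x0 \<in> topspace X"
begin

lemma subgroup_trivial: "subgroup {\<one>\<^bsub>pi1 X x0\<^esub>} (pi1 X x0)"
  using group_pi1[OF base] by (rule group.triv_subgroup)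

lemma topspace_pi1_topology: "topspace (pi1_topology X x0) = carrier (pi1 X x0)"
proof -
  have "topspace (pi1_topology X x0) = {c \<in> tilde_class X x0 {\<one>\<^bsub>pi1 X x0\<^esub>} ` paths_from X x0. endpoint_proj c = x0}"
    unfolding pi1_topology_def Let_def topspace_subtopology topspace_tilde_space[OF base subgroup_trivial] by blast
  also have "\<dots> = tilde_class X x0 {\<one>\<^bsub>pi1 X x0\<^esub>} `
      {\<alpha> \<in> paths_from X x0. endpoint_proj (tilde_class X x0 {\<one>\<^bsub>pi1 X x0\<^esub>} \<alpha>) = x0}"
    by blast
  also have "{\<alpha> \<in> paths_from X x0. endpoint_proj (tilde_class X x0 {\<one>\<^bsub>pi1 X x0\<^esub>} \<alpha>) = x0}
      = {\<alpha> \<in> paths_from X x0. \<alpha> 1 = x0}"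
    by (intro Collect_cong conj_cong refl) (simp only: endpoint_proj_tilde_class[OF base subgroup_trivial])
  also have "tilde_class X x0 {\<one>\<^bsub>pi1 X x0\<^esub>} ` {\<alpha> \<in> paths_from X x0. \<alpha> 1 = x0}
      = path_class X ` {\<alpha> \<in> paths_from X x0. \<alpha> 1 = x0}"
    by (intro image_cong refl tilde_class_trivial) simp
  also have "{\<alpha> \<in> paths_from X x0. \<alpha> 1 = x0} = loops X x0"
    by (auto simp: loops_def paths_from_def)
  finally show ?thesis by simp
qed

lemma saturation_trivial: "saturation X x0 {\<one>\<^bsub>pi1 X x0\<^esub>} \<U> = pi1_cover X \<U> x0"
proof -
  interpret group "pi1 X x0"
    using base by (rule group_pi1)
  interpret S: subgroup "pi1_cover X \<U> x0" "pi1 X x0"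
    using base by (rule subgroup_pi1_cover)
  show ?thesis
    unfolding saturation_def set_mult_def using r_one[OF S.mem_carrier] by (auto simp del: pi1_simps)
qed

end

context
  fixes X :: "'a topology" and x0 :: 'a and H :: "(real \<Rightarrow> 'a) set set"
  assumes base: "x0 \<in> topspace X" and H: "subgroup H (pi1 X x0)"
begin

text \<open>The neighbourhoods of \<open>g\<close> in the fundamental group are the cosets \<open>\<pi>(\<U>, x0) g\<close>, so the closure
  of a subgroup is the intersection of its saturations.\<close>

lemma closed_iff_Inter_saturation:
  "closedin (pi1_topology X x0) H \<longleftrightarrow>
    (\<forall>g \<in> carrier (pi1 X x0). (\<forall>\<U>. open_cover X \<U> \<longrightarrow> g \<in> saturation X x0 H \<U>) \<longrightarrow> g \<in> H)"
proof
  let ?T = "tilde_space X x0 {\<one>\<^bsub>pi1 X x0\<^esub>}"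
  let ?F = "{c \<in> topspace ?T. endpoint_proj c = x0}"
  interpret group "pi1 X x0"
    using base by (rule group_pi1)
  interpret H: subgroup H "pi1 X x0"
    by (rule H)
  interpret S: subgroup "pi1_cover X \<U> x0" "pi1 X x0" for \<U>
    using base by (rule subgroup_pi1_cover)
  {
    assume closed: "closedin (pi1_topology X x0) H"
    show "\<forall>g \<in> carrier (pi1 X x0). (\<forall>\<U>. open_cover X \<U> \<longrightarrow> g \<in> saturation X x0 H \<U>) \<longrightarrow> g \<in> H"
    proof (intro ballI impI, rule ccontr)
      fix g assume g: "g \<in> carrier (pi1 X x0)" "\<forall>\<U>. open_cover X \<U> \<longrightarrow> g \<in> saturation X x0 H \<U>" "g \<notin> H"
      have "openin (pi1_topology X x0) (carrier (pi1 X x0) - H)"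
        using closed by (simp only: closedin_def topspace_pi1_topology[OF base])
      then obtain W where W: "openin ?T W" "carrier (pi1 X x0) - H = W \<inter> ?F"
        unfolding pi1_topology_def Let_def openin_subtopology by blast
      obtain \<alpha> where \<alpha>: "g = path_class X \<alpha>" "\<alpha> \<in> loops X x0" "\<alpha> \<in> paths_from X x0"
        using g(1) by (rule carrier_classE)
      have "tilde_class X x0 {\<one>\<^bsub>pi1 X x0\<^esub>} \<alpha> \<in> W"
        using W(2) g(1,3) \<alpha> by (auto simp only: tilde_class_trivial)
      then obtain \<U> V where UV: "open_cover X \<U>" "V \<in> \<U>" "\<alpha> 1 \<in> V"
          "tilde_nbhd X x0 {\<one>\<^bsub>pi1 X x0\<^esub>} \<alpha> \<U> V \<subseteq> W"
        using openin_tilde_spaceD[OF base subgroup_trivial[OF base] W(1) \<alpha>(3)] by blast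
      obtain k h where kh: "k \<in> pi1_cover X \<U> x0" "h \<in> H" "g = k \<otimes>\<^bsub>pi1 X x0\<^esub> h"
        using g(2) UV(1) unfolding saturation_def set_mult_def by blast
      obtain \<eta> where \<eta>: "h = path_class X \<eta>" "\<eta> \<in> loops X x0" "\<eta> \<in> paths_from X x0"
        using H.mem_carrier[OF kh(2)] by (rule carrier_classE)
      \<comment> \<open>The element \<open>h\<close> of \<open>H\<close> is in the coset of \<open>g\<close>, hence in the neighbourhood of \<open>g\<close> that avoids \<open>H\<close>.\<close>
      have "h \<otimes>\<^bsub>pi1 X x0\<^esub> inv\<^bsub>pi1 X x0\<^esub> g = inv\<^bsub>pi1 X x0\<^esub> k"
        unfolding kh(3) using S.mem_carrier[OF kh(1)] H.mem_carrier[OF kh(2)]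
        by (simp add: inv_mult_group m_assoc[symmetric] del: pi1_simps)
      then have "path_class X (\<eta> \<frown> path_rev \<alpha>) \<in> pi1_cover X \<U> x0"
        using S.m_inv_closed[OF kh(1)] path_diff_eq_mult_inv[OF \<eta>(2) \<alpha>(2)] \<eta>(1) \<alpha>(1) by simp
      then have "path_equiv X (saturation X x0 {\<one>\<^bsub>pi1 X x0\<^esub>} \<U>) \<eta> \<alpha>"
        using \<eta>(2) \<alpha>(2) unfolding saturation_trivial[OF base] by (simp add: path_equiv_def loops_def)
      then have "tilde_class X x0 {\<one>\<^bsub>pi1 X x0\<^esub>} \<eta> \<in> W"
        using tilde_class_in_nbhd_if_equiv[OF base subgroup_trivial[OF base] \<alpha>(3) \<eta>(3) UV(3)] UV(4) by blast
      then have "h \<in> W"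
        using tilde_class_trivial[OF \<eta>(3)] \<eta>(1) by simp
      moreover have "h \<in> ?F"
        using H.mem_carrier[OF kh(2)] topspace_pi1_topology[OF base]
        unfolding pi1_topology_def Let_def topspace_subtopology by blast
      ultimately show False
        using W(2) kh(2) by blast
    qed
  }
  {
    assume inter: "\<forall>g \<in> carrier (pi1 X x0). (\<forall>\<U>. open_cover X \<U> \<longrightarrow> g \<in> saturation X x0 H \<U>) \<longrightarrow> g \<in> H"
    have "\<exists>N. openin (pi1_topology X x0) N \<and> g \<in> N \<and> N \<subseteq> carrier (pi1 X x0) - H"
      if g: "g \<in> carrier (pi1 X x0) - H" for g
    proof -
      obtain \<U> where \<U>: "open_cover X \<U>" "g \<notin> saturation X x0 H \<U>"
        using inter g by blast
      have "g \<in> carrier (pi1 X x0)" using g by blast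
      then obtain \<alpha> where \<alpha>: "g = path_class X \<alpha>" "\<alpha> \<in> loops X x0" "\<alpha> \<in> paths_from X x0"
        by (rule carrier_classE)
      obtain V where V: "V \<in> \<U>" "x0 \<in> V"
        using \<U>(1) base unfolding open_cover_def by blast
      have \<alpha>1: "\<alpha> 1 = x0"
        using \<alpha>(2) by (simp add: loops_def)
      let ?N = "tilde_nbhd X x0 {\<one>\<^bsub>pi1 X x0\<^esub>} \<alpha> \<U> V"
      have "openin ?T ?N"
        using openin_tilde_nbhd[OF base subgroup_trivial[OF base] \<U>(1) \<alpha>(3) V(1)] V(2) \<alpha>1 by simp
      then have "openin (pi1_topology X x0) (?N \<inter> ?F)"
        unfolding pi1_topology_def Let_def openin_subtopology by blast
      moreover have "g \<in> ?N \<inter> ?F"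
      proof
        have "tilde_class X x0 {\<one>\<^bsub>pi1 X x0\<^esub>} \<alpha> \<in> ?N"
          using \<alpha>(3) V(2) \<alpha>1 path_equiv_refl[OF base subgroup_saturation[OF base subgroup_trivial[OF base]]]
          by (intro tilde_class_in_nbhd_if_equiv[OF base subgroup_trivial[OF base]]) simp_all
        then show "g \<in> ?N"
          using tilde_class_trivial[OF \<alpha>(3)] \<alpha>(1) by simp
        show "g \<in> ?F"
          using \<open>g \<in> carrier (pi1 X x0)\<close> topspace_pi1_topology[OF base]
          unfolding pi1_topology_def Let_def topspace_subtopology by blast
      qed
      moreover have "?N \<inter> ?F \<subseteq> carrier (pi1 X x0) - H"
      proof
        fix c assume c: "c \<in> ?N \<inter> ?F"
        then have carrier: "c \<in> carrier (pi1 X x0)"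
          using topspace_pi1_topology[OF base] unfolding pi1_topology_def Let_def topspace_subtopology by blast
        then obtain \<beta> where \<beta>: "c = path_class X \<beta>" "\<beta> \<in> loops X x0" "\<beta> \<in> paths_from X x0"
          by (rule carrier_classE)
        let ?E = "path_equiv X (saturation X x0 {\<one>\<^bsub>pi1 X x0\<^esub>} \<U>)"
        note S' = subgroup_saturation[OF base subgroup_trivial[OF base], of \<U>]
        have "tilde_class X x0 {\<one>\<^bsub>pi1 X x0\<^esub>} \<beta> \<in> ?N"
          using c tilde_class_trivial[OF \<beta>(3)] \<beta>(1) by simp
        then obtain \<gamma> where \<gamma>: "\<gamma> \<in> paths_from (subtopology X V) (\<alpha> 1)" "?E \<beta> (\<alpha> \<frown> \<gamma>)"
          using tilde_class_in_nbhd_iff[OF base subgroup_trivial[OF base] \<alpha>(3) \<beta>(3)] by blast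
        have const: "(\<lambda>_. x0) \<in> paths_from (subtopology X V) (\<alpha> 1)"
          using base V(2) \<alpha>1 by (simp add: paths_from_def)
        have paths: "pathin X \<alpha>" "\<alpha> 0 = x0" "pathin X \<gamma>" "\<gamma> 0 = x0" "\<gamma> 1 = x0"
          using \<alpha>(3) \<gamma> \<beta>(2) \<alpha>1 by (simp_all add: paths_from_def pathin_subtopology path_equiv_def loops_def)
        have joins: "\<alpha> \<frown> \<gamma> \<in> paths_from X x0" "\<alpha> \<frown> (\<lambda>_. x0) \<in> paths_from X x0"
          using paths \<alpha>1 base by (simp_all add: paths_from_def pathin_join)
        \<comment> \<open>In the fiber \<open>\<gamma>\<close> is a loop in \<open>V\<close>, so it can be replaced by the constant path.\<close>
        have "?E (\<alpha> \<frown> \<gamma>) (\<alpha> \<frown> (\<lambda>_. x0))"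
          using \<alpha>(3) V(1) \<gamma>(1) const paths
          by (intro path_equiv_small[OF base S' subset_saturation(2)[OF base subgroup_trivial[OF base]]]) simp_all
        moreover have "?E (\<alpha> \<frown> (\<lambda>_. x0)) \<alpha>"
          using path_homotopic_units(1)[OF paths(1)] joins(2) \<alpha>1
          by (intro path_equiv_homotopic[OF base S']) simp_all
        ultimately have "?E (\<alpha> \<frown> \<gamma>) \<alpha>"
          using joins \<alpha>(3) by (rule path_equiv_trans[OF base S'])
        with \<gamma>(2) have "?E \<beta> \<alpha>"
          using \<beta>(3) joins(1) \<alpha>(3) by (rule path_equiv_trans[OF base S'])
        then have "?E \<alpha> \<beta>"
          using \<beta>(3) \<alpha>(3) by (rule path_equiv_sym[OF base S'])
        then have small: "g \<otimes>\<^bsub>pi1 X x0\<^esub> inv\<^bsub>pi1 X x0\<^esub> c \<in> pi1_cover X \<U> x0"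
          using path_diff_eq_mult_inv[OF \<alpha>(2) \<beta>(2)] \<alpha>(1) \<beta>(1)
          unfolding saturation_trivial[OF base] path_equiv_def by simp
        have "g = g \<otimes>\<^bsub>pi1 X x0\<^esub> inv\<^bsub>pi1 X x0\<^esub> c \<otimes>\<^bsub>pi1 X x0\<^esub> c"
          using \<open>g \<in> carrier (pi1 X x0)\<close> carrier by (simp add: m_assoc del: pi1_simps)
        then have "g \<in> saturation X x0 H \<U>" if "c \<in> H"
          unfolding saturation_def set_mult_def using small that by blast
        then show "c \<in> carrier (pi1 X x0) - H"
          using \<U>(2) carrier by blast
      qed
      ultimately show ?thesis
        by blast
    qed
    then have "openin (pi1_topology X x0) (carrier (pi1 X x0) - H)"
      by (subst openin_subopen) blast
    then show "closedin (pi1_topology X x0) H"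
      unfolding closedin_def topspace_pi1_topology[OF base] using H.subset by blast
  }
qed

end

section \<open>The three conditions\<close>

lemma const_path: "x \<in> topspace X \<Longrightarrow> (\<lambda>_. x) \<in> paths_from X x"
  by (simp add: paths_from_def)

context
  fixes X :: "'a topology" and x0 :: 'a and H :: "(real \<Rightarrow> 'a) set set"
  assumes base: "x0 \<in> topspace X" and H: "subgroup H (pi1 X x0)"
begin

abbreviation (input) "T \<equiv> tilde_space X x0 H"
abbreviation (input) "c0 \<equiv> tilde_base X x0 H"

lemma tilde_base_facts: "c0 \<in> topspace T" "endpoint_proj c0 = x0"
  using const_path[OF base] endpoint_proj_tilde_class[OF base H const_path[OF base]] topspace_tilde_space[OF base H]
  by (simp_all add: tilde_base_def)

lemma tilde_class_eq_base_iff: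
  assumes "\<alpha> \<in> loops X x0"
  shows "tilde_class X x0 H \<alpha> = c0 \<longleftrightarrow> path_class X \<alpha> \<in> H"
proof -
  have "\<alpha> \<in> paths_from X x0"
    using assms by (simp add: loops_def paths_from_def)
  then have "tilde_class X x0 H \<alpha> = c0 \<longleftrightarrow> path_equiv X H \<alpha> (\<lambda>_. x0)"
    unfolding tilde_base_def by (rule tilde_class_eq_iff[OF base H _ const_path[OF base]])
  also have "\<dots> \<longleftrightarrow> path_class X \<alpha> \<in> H"
    using assms base by (simp add: path_equiv_def loops_def path_class_simps)
  finally show ?thesis .
qed

lemma unique_path_lifting_iff_unique:
  "unique_path_lifting T c0 X x0 endpoint_proj \<longleftrightarrow>
    (\<forall>\<alpha> \<in> paths_from T c0. \<forall>\<beta> \<in> paths_from T c0.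
       (\<forall>t\<in>{0..1}. endpoint_proj (\<alpha> t) = endpoint_proj (\<beta> t)) \<longrightarrow> (\<forall>t\<in>{0..1}. \<alpha> t = \<beta> t))"
proof -
  have "\<exists>\<beta> \<in> paths_from T c0. \<forall>t\<in>{0..1}. endpoint_proj (\<beta> t) = \<alpha> t" if "\<alpha> \<in> paths_from X x0" for \<alpha>
    using path_lift[OF base H that] by metis
  then show ?thesis
    unfolding unique_path_lifting_def by blast
qed

text \<open>The difference of representatives of two lifts lies in every saturation, and a closed subgroup is
  the intersection of its saturations.\<close>

lemma unique_path_lifting_if_closed:
  assumes "closedin (pi1_topology X x0) H"
  shows "unique_path_lifting T c0 X x0 endpoint_proj"
  unfolding unique_path_lifting_iff_unique
proof (intro ballI impI)
  fix \<alpha> \<beta> t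
  assume \<alpha>: "\<alpha> \<in> paths_from T c0" and \<beta>: "\<beta> \<in> paths_from T c0" and t: "t \<in> {0..1::real}"
    and eq: "\<forall>t\<in>{0..1}. endpoint_proj (\<alpha> t) = endpoint_proj (\<beta> t)"
  have reps: "\<exists>a. \<forall>t\<in>{0..1}. a t \<in> paths_from X x0 \<and> \<gamma> t = tilde_class X x0 H (a t)"
    if "\<gamma> \<in> paths_from T c0" for \<gamma>
  proof -
    have "\<gamma> t \<in> topspace T" if "t \<in> {0..1}" for t
      using \<open>\<gamma> \<in> paths_from T c0\<close> that by (auto simp: paths_from_def pathin_def continuous_map_def Pi_iff)
    then have "\<forall>t\<in>{0..1}. \<exists>a. a \<in> paths_from X x0 \<and> \<gamma> t = tilde_class X x0 H a"
      unfolding topspace_tilde_space[OF base H] by blast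
    then show ?thesis
      by (rule bchoice)
  qed
  obtain a where a: "\<And>t. t \<in> {0..1} \<Longrightarrow> a t \<in> paths_from X x0" "\<And>t. t \<in> {0..1} \<Longrightarrow> \<alpha> t = tilde_class X x0 H (a t)"
    using reps[OF \<alpha>] by blast
  obtain b where b: "\<And>t. t \<in> {0..1} \<Longrightarrow> b t \<in> paths_from X x0" "\<And>t. t \<in> {0..1} \<Longrightarrow> \<beta> t = tilde_class X x0 H (b t)"
    using reps[OF \<beta>] by blast
  have ends: "a t 1 = b t 1" if "t \<in> {0..1}" for t
  proof -
    have "endpoint_proj (\<alpha> t) = endpoint_proj (\<beta> t)"
      using eq that by blast
    then show ?thesis
      using a[OF that] b[OF that] endpoint_proj_tilde_class[OF base H] by simp
  qed
  let ?g = "path_class X (a t \<frown> path_rev (b t))"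
  have "?g \<in> saturation X x0 H \<U>" if "open_cover X \<U>" for \<U>
    using lifts_equiv_saturation[OF base H that \<alpha> \<beta> a b ends t] by (simp add: path_equiv_def)
  moreover have "?g \<in> carrier (pi1 X x0)"
    using path_diff_loop[OF a(1)[OF t] b(1)[OF t] ends[OF t]] by simp
  ultimately have "?g \<in> H"
    using assms unfolding closed_iff_Inter_saturation[OF base H] by blast
  then have "path_equiv X H (a t) (b t)"
    using ends[OF t] by (simp add: path_equiv_def)
  then show "\<alpha> t = \<beta> t"
    using a[OF t] b[OF t] tilde_class_eq_iff[OF base H] by simp
qed

context
  assumes unique: "unique_path_lifting T c0 X x0 endpoint_proj"
begin

lemma lifts_eq:
  assumes "\<alpha> \<in> paths_from T c0" "\<beta> \<in> paths_from T c0"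
    and "\<And>t. t \<in> {0..1} \<Longrightarrow> endpoint_proj (\<alpha> t) = endpoint_proj (\<beta> t)" "t \<in> {0..1}"
  shows "\<alpha> t = \<beta> t"
  using unique assms unfolding unique_path_lifting_def by blast

text \<open>A null-homotopy of the projected loop lifts to the space of path classes. Each side of the
  lifted square is determined by uniqueness of lifts: one is the given loop, and the other three are
  constant, since they lift constant paths.\<close>

lemma loop_null_if_projection_null:
  assumes l: "l \<in> loops T c0" and null: "path_homotopic X (endpoint_proj \<circ> l) (\<lambda>_. x0)"
  shows "path_homotopic T l (\<lambda>_. c0)"
proof -
  obtain h where h: "continuous_map unit_square X h"
      "\<forall>t\<in>{0..1}. h (0, t) = (endpoint_proj \<circ> l) t \<and> h (1, t) = x0"
      "\<forall>s\<in>{0..1}. h (s, 0) = (endpoint_proj \<circ> l) 0 \<and> h (s, 1) = (endpoint_proj \<circ> l) 1"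
    using null unfolding path_homotopic_iff by blast
  have l': "l \<in> paths_from T c0" "l 0 = c0" "l 1 = c0"
    using l by (simp_all add: loops_def paths_from_def)
  have h00: "h (0, 0) = x0"
    using h(2) l'(2) tilde_base_facts(2) by simp
  let ?C = "{0..1::real} \<times> {0..1::real}"
  define \<zeta> where "\<zeta> = (\<lambda>z. tilde_class X x0 H (h \<circ> linepath (0, 0) z))"
  have C: "convex ?C" "(0, 0) \<in> ?C"
    by (simp_all add: convex_Times)
  have cont: "continuous_map unit_square T \<zeta>"
    unfolding \<zeta>_def by (rule continuous_segment_lift[OF base H C(1) h(1) C(2) h00])
  have proj: "endpoint_proj (\<zeta> z) = h z" if "z \<in> ?C" for z
    using endpoint_proj_tilde_class[OF base H segment_image_paths[OF base H C(1) h(1) C(2) h00 that]]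
    by (simp add: \<zeta>_def linepath_def flip: zero_prod_def)
  have "h \<circ> linepath (0, 0) (0, 0) = (\<lambda>_. x0)"
    using h00 by (simp add: comp_linepath_refl)
  then have corner: "\<zeta> (0, 0) = c0"
    by (simp add: \<zeta>_def tilde_base_def)
  have vertical: "pathin T (\<lambda>t. \<zeta> (s, t))" if "s \<in> {0..1}" for s
  proof -
    have "continuous_map unit_interval T (\<zeta> \<circ> (\<lambda>t. (s, t)))"
      using cont that by (intro continuous_map_compose[OF _ cont]) (auto intro!: continuous_intros)
    then show ?thesis by (simp add: pathin_def o_def)
  qed
  have horizontal: "pathin T (\<lambda>s. \<zeta> (s, t))" if "t \<in> {0..1}" for t
  proof -
    have "continuous_map unit_interval T (\<zeta> \<circ> (\<lambda>s. (s, t)))"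
      using cont that by (intro continuous_map_compose[OF _ cont]) (auto intro!: continuous_intros)
    then show ?thesis by (simp add: pathin_def o_def)
  qed
  have const: "(\<lambda>_. c0) \<in> paths_from T c0"
    using tilde_base_facts(1) by (simp add: paths_from_def)
  have left: "\<zeta> (0, t) = l t" if t: "t \<in> {0..1}" for t
  proof (rule lifts_eq[OF _ l'(1) _ t])
    show "(\<lambda>t. \<zeta> (0, t)) \<in> paths_from T c0"
      using vertical[of 0] corner by (simp add: paths_from_def)
    show "endpoint_proj (\<zeta> (0, t)) = endpoint_proj (l t)" if "t \<in> {0..1}" for t
      using proj[of "(0, t)"] h(2) that by simp
  qed
  have bottom: "\<zeta> (s, 0) = c0" if s: "s \<in> {0..1}" for s
  proof (rule lifts_eq[OF _ const _ s])
    show "(\<lambda>s. \<zeta> (s, 0)) \<in> paths_from T c0"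
      using horizontal[of 0] corner by (simp add: paths_from_def)
    show "endpoint_proj (\<zeta> (s, 0)) = endpoint_proj c0" if "s \<in> {0..1}" for s
      using proj[of "(s, 0)"] h(3) that l'(2) by simp
  qed
  have top: "\<zeta> (s, 1) = c0" if s: "s \<in> {0..1}" for s
  proof (rule lifts_eq[OF _ const _ s])
    show "(\<lambda>s. \<zeta> (s, 1)) \<in> paths_from T c0"
      using horizontal[of 1] left[of 1] l'(3) by (simp add: paths_from_def)
    show "endpoint_proj (\<zeta> (s, 1)) = endpoint_proj c0" if "s \<in> {0..1}" for s
      using proj[of "(s, 1)"] h(3) that l'(3) by simp
  qed
  have right: "\<zeta> (1, t) = c0" if t: "t \<in> {0..1}" for t
  proof (rule lifts_eq[OF _ const _ t])
    show "(\<lambda>t. \<zeta> (1, t)) \<in> paths_from T c0"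
      using vertical[of 1] bottom[of 1] by (simp add: paths_from_def)
    show "endpoint_proj (\<zeta> (1, t)) = endpoint_proj c0" if "t \<in> {0..1}" for t
      using proj[of "(1, t)"] h(2) that tilde_base_facts(2) by simp
  qed
  show ?thesis
    using cont left right bottom top l'(2,3) by (intro path_homotopicI[where h=\<zeta>]) simp_all
qed

lemma pi1_map_endpoint_proj_mon: "pi1_map X endpoint_proj \<in> mon (pi1 T c0) (pi1 X x0)"
proof -
  have hom: "pi1_map X endpoint_proj \<in> hom (pi1 T c0) (pi1 X x0)"
    using continuous_endpoint_proj[OF base H] tilde_base_facts(2) by (rule pi1_map_hom)
  have "group_hom (pi1 T c0) (pi1 X x0) (pi1_map X endpoint_proj)"
    using hom group_pi1[OF base] group_pi1[OF tilde_base_facts(1)]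
    by (simp add: group_hom_def group_hom_axioms_def)
  then interpret group_hom "pi1 T c0" "pi1 X x0" "pi1_map X endpoint_proj" .
  have "a = \<one>\<^bsub>pi1 T c0\<^esub>"
    if a: "a \<in> carrier (pi1 T c0)" "pi1_map X endpoint_proj a = \<one>\<^bsub>pi1 X x0\<^esub>" for a
  proof -
    obtain l where l: "a = path_class T l" "l \<in> loops T c0"
      using a(1) by auto
    then have "pi1_map X endpoint_proj a = path_class X (endpoint_proj \<circ> l)"
      using pi1_map_path_class[OF continuous_endpoint_proj[OF base H]] by (simp add: loops_def)
    then have "path_class X (endpoint_proj \<circ> l) = path_class X (\<lambda>_. x0)"
      using a(2) by simp
    then have "path_homotopic X (endpoint_proj \<circ> l) (\<lambda>_. x0)"
      using base by (intro path_class_eqD) simp_all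
    then have "path_homotopic T l (\<lambda>_. c0)"
      using l(2) by (intro loop_null_if_projection_null)
    then show ?thesis
      using l(1) path_class_eq by simp
  qed
  then have "inj_on (pi1_map X endpoint_proj) (carrier (pi1 T c0))"
    unfolding inj_on_one_iff by blast
  then show ?thesis
    using hom by (simp add: mon_def)
qed

text \<open>The lift of a loop \<open>\<alpha>\<close> that was built from segments ends at the class of \<open>\<alpha>\<close> modulo \<open>H\<close>. By
  uniqueness, a loop in the space of path classes is the lift of its projection.\<close>

lemma image_pi1_map_endpoint_proj: "pi1_map X endpoint_proj ` carrier (pi1 T c0) = H"
proof (intro equalityI subsetI)
  fix g assume "g \<in> pi1_map X endpoint_proj ` carrier (pi1 T c0)"
  then obtain l where l: "l \<in> loops T c0" "g = pi1_map X endpoint_proj (path_class T l)"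
    by auto
  have path: "l \<in> paths_from T c0" "l 1 = c0"
    using l(1) by (simp_all add: loops_def paths_from_def)
  then have "pathin X (endpoint_proj \<circ> l)"
    using pathin_compose[OF _ continuous_endpoint_proj[OF base H]] by (simp add: paths_from_def)
  then have down: "endpoint_proj \<circ> l \<in> loops X x0" "endpoint_proj \<circ> l \<in> paths_from X x0"
    using path tilde_base_facts(2) by (simp_all add: loops_def paths_from_def)
  obtain \<beta> where \<beta>: "\<beta> \<in> paths_from T c0" "\<And>t. t \<in> {0..1} \<Longrightarrow> endpoint_proj (\<beta> t) = (endpoint_proj \<circ> l) t"
      "\<beta> 1 = tilde_class X x0 H (endpoint_proj \<circ> l)"
    using path_lift[OF base H down(2)] by blast
  have "l 1 = \<beta> 1"
    using \<beta>(2) by (intro lifts_eq[OF path(1) \<beta>(1)]) simp_all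
  then have "tilde_class X x0 H (endpoint_proj \<circ> l) = c0"
    using \<beta>(3) path(2) by simp
  moreover have "g = path_class X (endpoint_proj \<circ> l)"
    using l pi1_map_path_class[OF continuous_endpoint_proj[OF base H]] by (simp add: loops_def)
  ultimately show "g \<in> H"
    using tilde_class_eq_base_iff[OF down(1)] by simp
next
  fix g assume g: "g \<in> H"
  then have "g \<in> carrier (pi1 X x0)"
    using subgroup.mem_carrier[OF H] by blast
  then obtain \<alpha> where \<alpha>: "g = path_class X \<alpha>" "\<alpha> \<in> loops X x0" "\<alpha> \<in> paths_from X x0"
    by (rule carrier_classE)
  obtain \<beta> where \<beta>: "\<beta> \<in> paths_from T c0" "\<And>t. t \<in> {0..1} \<Longrightarrow> endpoint_proj (\<beta> t) = \<alpha> t"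
      "\<beta> 1 = tilde_class X x0 H \<alpha>"
    using path_lift[OF base H \<alpha>(3)] by blast
  have loop: "\<beta> \<in> loops T c0"
    using \<beta>(1,3) tilde_class_eq_base_iff[OF \<alpha>(2)] g \<alpha>(1) by (simp add: loops_def paths_from_def)
  have "path_homotopic X \<alpha> (endpoint_proj \<circ> \<beta>)"
    using \<alpha>(3) \<beta>(2) by (intro path_homotopic_if_eq_on) (simp_all add: paths_from_def)
  then have "g = path_class X (endpoint_proj \<circ> \<beta>)"
    unfolding \<alpha>(1) by (rule path_class_eq)
  also have "\<dots> = pi1_map X endpoint_proj (path_class T \<beta>)"
    using loop pi1_map_path_class[OF continuous_endpoint_proj[OF base H]] by (simp add: loops_def)
  finally show "g \<in> pi1_map X endpoint_proj ` carrier (pi1 T c0)"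
    using loop by simp
qed

end

lemma equiv_saturations_indistinguishable:
  assumes "\<alpha> \<in> paths_from X x0" "\<beta> \<in> paths_from X x0"
    and "\<And>\<U>. open_cover X \<U> \<Longrightarrow> path_equiv X (saturation X x0 H \<U>) \<alpha> \<beta>"
    and "openin T W" "tilde_class X x0 H \<beta> \<in> W"
  shows "tilde_class X x0 H \<alpha> \<in> W"
proof -
  obtain \<U> V where "open_cover X \<U>" "V \<in> \<U>" "\<beta> 1 \<in> V" "tilde_nbhd X x0 H \<beta> \<U> V \<subseteq> W"
    using openin_tilde_spaceD[OF base H assms(4,2,5)] by blast
  then show ?thesis
    using tilde_class_in_nbhd_if_equiv[OF base H assms(2,1) _ assms(3)] by blast
qed

text \<open>If \<open>[\<alpha>]\<close> lies in the closure of \<open>H\<close>, then the class of \<open>\<alpha>\<close> modulo \<open>H\<close> has the same neighbourhoods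
  as the base point. So the lift of \<open>\<alpha>\<close> remains continuous when its end point is replaced by the base
  point, and \<open>[\<alpha>]\<close> is the image of the resulting loop.\<close>

lemma closed_if_image_pi1_map:
  assumes "pi1_map X endpoint_proj ` carrier (pi1 T c0) = H"
  shows "closedin (pi1_topology X x0) H"
  unfolding closed_iff_Inter_saturation[OF base H]
proof (intro ballI impI)
  fix g assume g: "g \<in> carrier (pi1 X x0)" "\<forall>\<U>. open_cover X \<U> \<longrightarrow> g \<in> saturation X x0 H \<U>"
  obtain \<alpha> where \<alpha>: "g = path_class X \<alpha>" "\<alpha> \<in> loops X x0" "\<alpha> \<in> paths_from X x0"
    using g(1) by (rule carrier_classE)
  obtain \<beta> where \<beta>: "\<beta> \<in> paths_from T c0" "\<And>t. t \<in> {0..1} \<Longrightarrow> endpoint_proj (\<beta> t) = \<alpha> t"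
      "\<beta> 1 = tilde_class X x0 H \<alpha>"
    using path_lift[OF base H \<alpha>(3)] by blast
  have equiv: "path_equiv X (saturation X x0 H \<U>) \<alpha> (\<lambda>_. x0)" if "open_cover X \<U>" for \<U>
    using g(2) that \<alpha>(1,2) base by (simp add: path_equiv_def loops_def path_class_simps)
  have equiv': "path_equiv X (saturation X x0 H \<U>) (\<lambda>_. x0) \<alpha>" if "open_cover X \<U>" for \<U>
    using equiv[OF that] \<alpha>(3) const_path[OF base] by (rule path_equiv_sym[OF base subgroup_saturation[OF base H]])
  have same: "\<beta> 1 \<in> W \<longleftrightarrow> c0 \<in> W" if "openin T W" for W
    using equiv_saturations_indistinguishable[OF \<alpha>(3) const_path[OF base] equiv that]
      equiv_saturations_indistinguishable[OF const_path[OF base] \<alpha>(3) equiv' that]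
    unfolding \<beta>(3) tilde_base_def by blast
  define l where "l = \<beta>(1 := c0)"
  have "continuous_map unit_interval T l"
    unfolding continuous_map
  proof (intro conjI allI impI)
    have "\<beta> ` topspace unit_interval \<subseteq> topspace T"
      using \<beta>(1) by (auto simp: paths_from_def pathin_def continuous_map_def Pi_iff)
    then show "l ` topspace unit_interval \<subseteq> topspace T"
      using tilde_base_facts(1) by (auto simp: l_def)
  next
    fix W assume W: "openin T W"
    have "{t \<in> topspace unit_interval. l t \<in> W} = {t \<in> topspace unit_interval. \<beta> t \<in> W}"
      using same[OF W] by (auto simp: l_def)
    also have "openin unit_interval \<dots>"
      using \<beta>(1) W by (intro openin_continuous_map_preimage) (simp_all add: paths_from_def pathin_def)
    finally show "openin unit_interval {t \<in> topspace unit_interval. l t \<in> W}" .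
  qed
  then have loop: "l \<in> loops T c0"
    using \<beta>(1) by (simp add: l_def loops_def paths_from_def pathin_def)
  have "endpoint_proj (l t) = \<alpha> t" if "t \<in> {0..1}" for t
    using \<beta>(2)[OF that] \<alpha>(2) tilde_base_facts(2) by (simp add: l_def loops_def)
  then have "path_homotopic X \<alpha> (endpoint_proj \<circ> l)"
    using \<alpha>(3) by (intro path_homotopic_if_eq_on) (simp_all add: paths_from_def)
  then have "g = path_class X (endpoint_proj \<circ> l)"
    unfolding \<alpha>(1) by (rule path_class_eq)
  also have "\<dots> = pi1_map X endpoint_proj (path_class T l)"
    using loop pi1_map_path_class[OF continuous_endpoint_proj[OF base H]] by (simp add: loops_def)
  also have "\<dots> \<in> pi1_map X endpoint_proj ` carrier (pi1 T c0)"
    using loop by simp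
  finally show "g \<in> H"
    using assms by simp
qed

end

theorem theorem4p6:
  fixes X :: "'a topology" and x0 :: 'a and G :: "(real \<Rightarrow> 'a) set set"
  assumes "x0 \<in> topspace X"
    and "G \<lhd> pi1 X x0"
  shows "(unique_path_lifting (tilde_space X x0 G) (tilde_base X x0 G) X x0 endpoint_proj
            \<longleftrightarrow> closedin (pi1_topology X x0) G)
       \<and> (closedin (pi1_topology X x0) G
            \<longleftrightarrow> pi1_map X endpoint_proj
                  \<in> mon (pi1 (tilde_space X x0 G) (tilde_base X x0 G)) (pi1 X x0)
              \<and> pi1_map X endpoint_proj
                  ` carrier (pi1 (tilde_space X x0 G) (tilde_base X x0 G)) = G)"
proof -
  have G: "subgroup G (pi1 X x0)"
    using assms(2) by (rule normal_imp_subgroup)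
  show ?thesis
    using unique_path_lifting_if_closed[OF assms(1) G] pi1_map_endpoint_proj_mon[OF assms(1) G]
      image_pi1_map_endpoint_proj[OF assms(1) G] closed_if_image_pi1_map[OF assms(1) G]
    by blast
qed

end
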